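(* Let $n,k\ge 1$, let $S=S(X,B_1,\ldots,B_k)$ be an interlaced symmetric word, and let $B_1,\ldots,B_k$ be real $n\times n$ positive definite matrices. Then for almost every real $n\times n$ positive definite matrix $P$ (with respect to Lebesgue measure on the space of real symmetric $n\times n$ matrices), the equation $$S(X,B_1,\ldots,B_k)=P$$ has an odd (and thus finite) number of real positive definite solutions $X$.
   Context: Real positive definite matrices are real symmetric matrices with all eigenvalues positive. Words are elements of the free monoid on the letters $X,B_1,\ldots,B_k$. A word is symmetric if it equals its reversal (palindrome). A word is interlaced if it has the form $W=B_{i_1}^{q_1}\prod_{j=1}^{m}X^{p_j}B_{i_{j+1}}^{q_{j+1}}$ with $m\ge 1$, integers $p_j>0$, $q_j\ge 0$ and $i_j\in\{1,\ldots,k\}$ (the zeroth power of a letter is the empty word). $S(X,B_1,\ldots,B_k)$ denotes the matrix product obtained by substituting matrices for letters. The space of real symmetric $n\times n$ matrices is identified with $\mathbb{R}^{n(n+1)/2}$ via the lower triangular entries. *)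

theory Defs
  imports "HOL-Analysis.Analysis"
begin

section \<open>Words in the letters \<open>X, B\<^sub>1, B\<^sub>2, \<dots>\<close>\<close>

datatype letter = LX | LB nat

type_synonym word = "letter list"

definition symmetric_word :: "word \<Rightarrow> bool" where
  "symmetric_word w \<longleftrightarrow> rev w = w"

text \<open>
  \<open>replicate q b\<close> is the power \<open>b\<^sup>q\<close> in the free monoid; the product over \<open>j = 1, \<dots>, m\<close> is taken
  in increasing order of \<open>j\<close>.
\<close>

definition interlaced_form ::
    "nat \<Rightarrow> (nat \<Rightarrow> nat) \<Rightarrow> (nat \<Rightarrow> nat) \<Rightarrow> (nat \<Rightarrow> nat) \<Rightarrow> word" where
  "interlaced_form m i p q =
     replicate (q 1) (LB (i 1)) @
     concat (map (\<lambda>j. replicate (p j) LX @ replicate (q (j + 1)) (LB (i (j + 1)))) [1..<m + 1])"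

definition interlaced :: "nat \<Rightarrow> word \<Rightarrow> bool" where
  "interlaced k w \<longleftrightarrow>
     (\<exists>m i p q. 1 \<le> m \<and> (\<forall>j\<in>{1..m}. 0 < p j) \<and> (\<forall>j\<in>{1..m + 1}. i j \<in> {1..k}) \<and>
        w = interlaced_form m i p q)"

fun letter_matrix :: "real^'n^'n \<Rightarrow> (nat \<Rightarrow> real^'n^'n) \<Rightarrow> letter \<Rightarrow> real^'n^'n" where
  "letter_matrix X B LX = X"
| "letter_matrix X B (LB i) = B i"

definition word_matrix :: "word \<Rightarrow> real^'n^'n \<Rightarrow> (nat \<Rightarrow> real^'n^'n) \<Rightarrow> real^'n^'n" where
  "word_matrix w X B = foldr (\<lambda>l M. letter_matrix X B l ** M) w (mat 1)"


section \<open>Positive definite matrices\<close>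

definition symmetric_matrix :: "real^'n^'n \<Rightarrow> bool" where
  "symmetric_matrix A \<longleftrightarrow> transpose A = A"

text \<open>
  Only real eigenvalues are considered; this is no restriction, as \<open>eigenvalue\<close> is
  applied to real symmetric matrices only.
\<close>

definition eigenvalue :: "real^'n^'n \<Rightarrow> real \<Rightarrow> bool" where
  "eigenvalue A e \<longleftrightarrow> (\<exists>v. v \<noteq> 0 \<and> A *v v = e *s v)"

definition positive_definite :: "real^'n^'n \<Rightarrow> bool" where
  "positive_definite A \<longleftrightarrow> symmetric_matrix A \<and> (\<forall>e. eigenvalue A e \<longrightarrow> 0 < e)"


section \<open>Lebesgue measure on the space of symmetric matrices\<close>

text \<open>
  The index type carries an order so that the lower triangular entries make sense. Every
  finite linear order is a well-order, so the class \<open>wellorder\<close> (which the library's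
  change-of-variables theory also uses) does not restrict the dimension.
\<close>

definition lower_index :: "('n::{finite,wellorder} \<times> 'n::{finite,wellorder}) set" where
  "lower_index = {(i, j). j \<le> i}"

definition symmetric_of_lower ::
    "('n::{finite,wellorder} \<times> 'n::{finite,wellorder} \<Rightarrow> real) \<Rightarrow> real^'n::{finite,wellorder}^'n::{finite,wellorder}" where
  "symmetric_of_lower v = (\<chi> i j. if j \<le> i then v (i, j) else v (j, i))"

text \<open>
  The measure below is defined on the Borel sets, without completing it; this makes no
  difference for statements of the form \<open>AE\<close>, which only ask that the exceptional set
  be contained in a null set.
\<close>

definition lebesgue_symmetric :: "(real^'n::{finite,wellorder}^'n::{finite,wellorder}) measure" where
  "lebesgue_symmetric =
     distr (\<Pi>\<^sub>M ij\<in>lower_index. (lborel :: real measure))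
       (restrict_space borel {A. symmetric_matrix A}) symmetric_of_lower"

lemma symmetric_of_lower_symmetric: "symmetric_matrix (symmetric_of_lower v)"
  by (auto simp: symmetric_matrix_def symmetric_of_lower_def transpose_def vec_eq_iff)

lemma card_lower_index:
  "card (lower_index :: ('n::{finite,wellorder} \<times> 'n::{finite,wellorder}) set) =
     CARD('n) * (CARD('n) + 1) div 2"
proof -
  let ?L = "lower_index :: ('n \<times> 'n) set" and ?D = "range (\<lambda>i::'n. (i, i))"
  have sw: "card (prod.swap ` ?L) = card ?L" by (rule card_image) simp
  have D: "card ?D = CARD('n)" by (rule card_image) (simp add: inj_on_def)
  have "?L \<union> prod.swap ` ?L = UNIV"
    by (fastforce simp: lower_index_def image_iff)
  moreover have "?L \<inter> prod.swap ` ?L = ?D"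
    by (auto simp: lower_index_def image_iff)
  ultimately have "card ?L + card ?L = CARD('n \<times> 'n) + CARD('n)"
    using card_Un_Int[of ?L "prod.swap ` ?L"] sw D by simp
  then have "2 * card ?L = CARD('n) * (CARD('n) + 1)" by (simp add: algebra_simps)
  then show ?thesis by (metis nonzero_mult_div_cancel_left zero_neq_numeral)
qed

lemma measurable_symmetric_of_lower:
  "symmetric_of_lower \<in> measurable (\<Pi>\<^sub>M ij\<in>lower_index. (lborel :: real measure))
     (restrict_space borel
       {A :: real^'n::{finite,wellorder}^'n::{finite,wellorder}. symmetric_matrix A})"
proof (rule measurable_restrict_space2)
  let ?M = "\<Pi>\<^sub>M ij\<in>lower_index. (lborel :: real measure)"
  have comp: "(\<lambda>v. symmetric_of_lower v $ i $ j) \<in> borel_measurable ?M" for i j :: 'n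
    by (cases "j \<le> i")
      (auto simp: symmetric_of_lower_def lower_index_def intro!: measurable_component_singleton)
  have "(\<lambda>v. symmetric_of_lower v \<bullet> b) \<in> borel_measurable ?M" if "b \<in> Basis"
    for b :: "real^'n::{finite,wellorder}^'n::{finite,wellorder}"
  proof -
    from that obtain i j where "b = axis i (axis j 1)" by (auto simp: Basis_vec_def)
    then show ?thesis using comp[of i j] by (simp add: inner_axis)
  qed
  then show "(symmetric_of_lower :: _ \<Rightarrow> real^'n::{finite,wellorder}^'n::{finite,wellorder}) \<in> borel_measurable ?M"
    by (subst borel_measurable_euclidean_space) auto
qed (auto simp: symmetric_of_lower_symmetric)

lemma AE_lebesgue_symmetric_iff:
  fixes Q :: "real^'n::{finite,wellorder}^'n::{finite,wellorder} \<Rightarrow> bool"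
  shows "(AE P in lebesgue_symmetric. Q P) \<longleftrightarrow>
    (AE v in (\<Pi>\<^sub>M ij\<in>lower_index. (lborel :: real measure)). Q (symmetric_of_lower v))"
    (is "?L \<longleftrightarrow> ?R")
proof
  assume ?L
  then show ?R
    unfolding lebesgue_symmetric_def by (rule AE_distrD[OF measurable_symmetric_of_lower])
next
  let ?M = "\<Pi>\<^sub>M ij\<in>lower_index. (lborel :: real measure)"
  let ?S = "restrict_space borel
       {A :: real^'n::{finite,wellorder}^'n::{finite,wellorder}. symmetric_matrix A}"
  let ?g = "\<lambda>A :: real^'n::{finite,wellorder}^'n::{finite,wellorder}.
    \<lambda>ij\<in>lower_index. A $ fst ij $ snd ij"
  assume ?R
  then obtain N where N: "{v \<in> space ?M. \<not> Q (symmetric_of_lower v)} \<subseteq> N" "emeasure ?M N = 0"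
    "N \<in> sets ?M"
    by (rule AE_E)
  have g: "?g \<in> measurable ?S ?M"
    by (intro measurable_restrict measurable_restrict_space1)
      (simp add: borel_measurable_continuous_onI continuous_intros)
  have gs: "?g (symmetric_of_lower v) = v" if "v \<in> space ?M" for v
    using that
    by (auto simp: space_PiM PiE_def extensional_def symmetric_of_lower_def lower_index_def
        fun_eq_iff restrict_def)
  have sg: "symmetric_of_lower (?g A) = A" if "symmetric_matrix A" for A
  proof -
    have "A $ i $ j = A $ j $ i" for i j
      using that unfolding symmetric_matrix_def transpose_def by (metis vec_lambda_beta)
    then show ?thesis
      by (auto simp: vec_eq_iff symmetric_of_lower_def lower_index_def)
  qed
  let ?N = "?g -` N \<inter> space ?S"
  have N': "?N \<in> sets ?S" using g N(3) by (rule measurable_sets)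
  have "symmetric_of_lower -` ?N \<inter> space ?M = N"
    using sets.sets_into_space[OF N(3)] gs
    by (auto simp: space_restrict_space symmetric_of_lower_symmetric)
  then have "?N \<in> null_sets lebesgue_symmetric"
    using N' N(2) unfolding lebesgue_symmetric_def
    by (auto simp: null_sets_def emeasure_distr[OF measurable_symmetric_of_lower])
  moreover have "{P \<in> space lebesgue_symmetric. \<not> Q P} \<subseteq> ?N"
  proof
    fix P assume "P \<in> {P \<in> space lebesgue_symmetric. \<not> Q P}"
    then have P: "symmetric_matrix P" "\<not> Q P"
      by (auto simp: lebesgue_symmetric_def space_restrict_space)
    have "?g P \<in> space ?M" by (auto simp: space_PiM)
    with P sg have "?g P \<in> N" using N(1) by auto
    with P show "P \<in> ?N" by (simp add: space_restrict_space)
  qed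
  ultimately show ?L by (rule AE_I')
qed

end

theory Submission
  imports Defs
begin

text \<open>
  The number of solutions is computed modulo 2 by an analytic degree. Deform the problem along the
  segments \<open>B\<^sub>i(t) = (1 - t) I + t B\<^sub>i\<close>, \<open>P(t) = (1 - t) I + t P\<close> and write \<open>H\<^sub>t(X) = S(X, B(t)) - P(t)\<close>,
  a polynomial in \<open>(t, X)\<close>. Interlacing makes \<open>S(Y, B(t)) \<noteq> 0\<close> for every symmetric \<open>Y \<noteq> 0\<close>, so by
  homogeneity and compactness the symmetric zeros of all \<open>H\<^sub>t\<close> lie in one ball; a positive semidefinite
  zero is invertible, hence positive definite. Thus no \<open>H\<^sub>t\<close> vanishes on the boundary of
  \<open>G = {X positive definite, |X| < R}\<close>. For a bump function \<open>\<phi>\<close> supported near the origin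
  \<open>\<integral>\<^sub>G \<phi>(H\<^sub>t) det DH\<^sub>t\<close> does not depend on \<open>t\<close>, because its derivative is a sum of null Lagrangians; if
  the zeros of \<open>H\<^sub>t\<close> are regular, it equals \<open>\<integral>\<phi>\<close> times the sum of the signs of \<open>det DH\<^sub>t\<close> at the zeros,
  which has the parity of their number. At \<open>t = 0\<close> the equation is \<open>X\<^sup>d = I\<close>, whose only
  positive definite solution is the regular zero \<open>I\<close>; at \<open>t = 1\<close> almost every \<open>P\<close> is a regular
  value by Sard's theorem.
\<close>

section \<open>Derivatives of polynomial functions and null Lagrangians\<close>

text \<open>The direction comes first so that \<open>dirderiv v\<close> is an operator on functions
  that can be iterated. It maps polynomial functions to polynomial functions, so for these
  derivatives of every order are at hand.\<close>

definition dirderiv :: "'a::real_normed_vector \<Rightarrow> ('a \<Rightarrow> real) \<Rightarrow> 'a \<Rightarrow> real" where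
  "dirderiv v f x = frechet_derivative f (at x) v"

lemma dirderiv_eqI: "(f has_derivative f') (at x) \<Longrightarrow> dirderiv v f x = f' v"
  unfolding dirderiv_def using frechet_derivative_at by metis

lemma has_derivative_real_polynomial_function:
  fixes f :: "'a::real_normed_vector \<Rightarrow> real"
  assumes "real_polynomial_function f"
  shows "(f has_derivative (\<lambda>v. dirderiv v f x)) (at x)"
  using differentiable_at_real_polynomial_function[OF assms]
  by (simp add: dirderiv_def[abs_def] frechet_derivative_works)

lemma continuous_on_real_polynomial_function:
  fixes f :: "'a::real_normed_vector \<Rightarrow> real"
  shows "real_polynomial_function f \<Longrightarrow> continuous_on S f"
  using has_derivative_real_polynomial_function has_derivative_continuous
  by (meson continuous_at_imp_continuous_on)

lemma dirderiv_linear: "bounded_linear f \<Longrightarrow> dirderiv v f = (\<lambda>x. f v)"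
  by (intro ext dirderiv_eqI bounded_linear_imp_has_derivative)

lemma dirderiv_const [simp]: "dirderiv v (\<lambda>x. c) = (\<lambda>x. 0)"
  by (intro ext dirderiv_eqI) (rule has_derivative_const)

lemma dirderiv_add:
  assumes "real_polynomial_function f" "real_polynomial_function g"
  shows "dirderiv v (\<lambda>x. f x + g x) = (\<lambda>x. dirderiv v f x + dirderiv v g x)"
  by (intro ext dirderiv_eqI)
    (rule has_derivative_add[OF assms[THEN has_derivative_real_polynomial_function]])

lemma dirderiv_mult:
  assumes "real_polynomial_function f" "real_polynomial_function g"
  shows "dirderiv v (\<lambda>x. f x * g x) = (\<lambda>x. f x * dirderiv v g x + dirderiv v f x * g x)"
  by (intro ext dirderiv_eqI)
    (rule has_derivative_mult[OF assms[THEN has_derivative_real_polynomial_function]])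

lemma dirderiv_sum:
  assumes "\<And>i. i \<in> I \<Longrightarrow> real_polynomial_function (f i)"
  shows "dirderiv v (\<lambda>x. \<Sum>i\<in>I. f i x) = (\<lambda>x. \<Sum>i\<in>I. dirderiv v (f i) x)"
  by (intro ext dirderiv_eqI has_derivative_sum has_derivative_real_polynomial_function assms)

lemma dirderiv_prod:
  assumes "\<And>i. i \<in> I \<Longrightarrow> real_polynomial_function (f i)"
  shows "dirderiv v (\<lambda>x. \<Prod>i\<in>I. f i x) =
    (\<lambda>x. \<Sum>i\<in>I. dirderiv v (f i) x * (\<Prod>j\<in>I - {i}. f j x))"
  by (intro ext dirderiv_eqI has_derivative_prod has_derivative_real_polynomial_function assms)

lemma real_polynomial_function_dirderiv [intro]:
  "real_polynomial_function f \<Longrightarrow> real_polynomial_function (dirderiv v f)"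
proof (induction rule: real_polynomial_function.induct)
  case (linear f)
  then show ?case by (simp add: dirderiv_linear real_polynomial_function.intros(2))
qed (auto simp: dirderiv_add dirderiv_mult)

text \<open>Structural induction: second derivatives of linear functions vanish, and the product
  rule applied twice is symmetric in \<open>u\<close> and \<open>v\<close> up to the induction
  hypotheses.\<close>

lemma dirderiv_commute:
  "real_polynomial_function f \<Longrightarrow> dirderiv u (dirderiv v f) = dirderiv v (dirderiv u f)"
proof (induction rule: real_polynomial_function.induct)
  case (linear f)
  then show ?case by (simp add: dirderiv_linear)
next
  case (mult f g)
  then show ?case
    by (simp add: dirderiv_add dirderiv_mult real_polynomial_function_dirderiv
        real_polynomial_function.intros(4) algebra_simps)
qed (simp_all add: dirderiv_add real_polynomial_function_dirderiv)

lemma dirderiv_Pair: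
  fixes f :: "real \<times> 'a::real_normed_vector \<Rightarrow> real"
  assumes "real_polynomial_function f"
  shows "dirderiv v (\<lambda>x. f (t, x)) x = dirderiv (0, v) f (t, x)"
proof -
  have "((\<lambda>x. f (t, x)) has_derivative (\<lambda>v. dirderiv (0, v) f (t, x))) (at x)"
    by (rule has_derivative_compose[OF _ has_derivative_real_polynomial_function[OF assms]])
      (auto intro!: derivative_eq_intros)
  then show ?thesis by (rule dirderiv_eqI)
qed

lemma real_polynomial_function_Pair:
  fixes f :: "real \<times> 'a::euclidean_space \<Rightarrow> real"
  assumes "real_polynomial_function f"
  shows "real_polynomial_function (\<lambda>x. f (t, x))"
  using assms
proof (induction rule: real_polynomial_function.induct)
  case (linear f)
  \<comment> \<open>Freezing the first argument turns a linear function into an affine one, which is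
    still polynomial.\<close>
  have eq: "f (t, x) = f (t, 0) + f (0, x)" for x
    using linear_add[OF bounded_linear.linear[OF linear], of "(t, 0)" "(0, x)"] by simp
  have "bounded_linear (\<lambda>x. f (0, x))"
    by (rule bounded_linear_compose[OF linear bounded_linear_Pair[OF bounded_linear_zero bounded_linear_ident]])
  then have "real_polynomial_function (\<lambda>x. f (t, 0) + f (0, x))"
    by (intro real_polynomial_function.intros(1-3))
  then show ?case by (simp only: eq[symmetric])
qed auto

section \<open>Integration by parts and null Lagrangians\<close>

lemma integral_cbox_superset:
  fixes f :: "'a::euclidean_space \<Rightarrow> 'b::banach"
  assumes "cbox a b \<subseteq> cbox c d" "\<And>x. x \<notin> cbox a b \<Longrightarrow> f x = 0"
  shows "integral (cbox c d) f = integral (cbox a b) f"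
proof -
  have "integral (cbox c d) (\<lambda>x. if x \<in> cbox a b then f x else 0) = integral (cbox c d \<inter> cbox a b) f"
    by (metis integral_restrict_Int inf_commute)
  moreover have "(\<lambda>x. if x \<in> cbox a b then f x else 0) = f" using assms(2) by auto
  moreover have "cbox c d \<inter> cbox a b = cbox a b" using assms(1) by auto
  ultimately show ?thesis by simp
qed

text \<open>The integral of a translate does not depend on the translation; differentiate at zero.\<close>

lemma integral_derivative_compact_support:
  fixes w :: "'a::euclidean_space \<Rightarrow> real" and w' :: "'a \<Rightarrow> 'a \<Rightarrow> real"
  assumes der: "\<And>x. (w has_derivative w' x) (at x)"
    and cont: "continuous_on UNIV (\<lambda>x. w' x e)"
    and supp: "\<And>x. x \<notin> cbox a b \<Longrightarrow> w x = 0" "\<And>x. x \<notin> cbox a b \<Longrightarrow> w' x e = 0"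
  shows "integral (cbox a b) (\<lambda>x. w' x e) = 0"
proof -
  \<comment> \<open>One box \<open>cbox (-c) c\<close> is made large enough to hold the supports of
    all translates by \<open>s *\<^sub>R e\<close> with \<open>s\<close> between -1 and 1.\<close>
  have "bounded ((\<lambda>(s, x). x - s *\<^sub>R e) ` ({-1..1} \<times> cbox a b))"
    by (intro compact_imp_bounded compact_continuous_image compact_Times)
      (auto simp: split_beta intro!: continuous_intros)
  then obtain c where c: "(\<lambda>(s, x). x - s *\<^sub>R e) ` ({-1..1} \<times> cbox a b) \<subseteq> cbox (-c) c"
    by (rule bounded_subset_cbox_symmetric)
  have sub: "cbox a b \<subseteq> cbox (-c + s *\<^sub>R e) (c + s *\<^sub>R e)" if "s \<in> {-1..1}" for s
  proof
    fix x assume "x \<in> cbox a b"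
    then have "x - s *\<^sub>R e \<in> cbox (-c) c" using c that by force
    then have "s *\<^sub>R e + (x - s *\<^sub>R e) \<in> cbox (s *\<^sub>R e + -c) (s *\<^sub>R e + c)"
      unfolding cbox_translation by blast
    then show "x \<in> cbox (-c + s *\<^sub>R e) (c + s *\<^sub>R e)" by (simp add: add.commute)
  qed
  have contw: "continuous_on S w" for S
    using der has_derivative_continuous by (meson continuous_at_imp_continuous_on)
  have I: "integral (cbox (-c) c) (\<lambda>x. w (s *\<^sub>R e + x)) = integral (cbox a b) w" if "s \<in> {-1..1}" for s
    using integral_shift_cbox_plus[of "-c" c w "s *\<^sub>R e"]
      integral_cbox_superset[OF sub[OF that], of w] supp(1) by (simp add: o_def)
  have d: "((\<lambda>s. w (s *\<^sub>R e + x)) has_vector_derivative w' (s *\<^sub>R e + x) e) (at s within U)" for s x U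
  proof -
    have "((\<lambda>s. w (s *\<^sub>R e + x)) has_derivative (\<lambda>h. w' (s *\<^sub>R e + x) (h *\<^sub>R e))) (at s within U)"
      by (rule has_derivative_compose[OF _ der]) (auto intro!: derivative_eq_intros)
    moreover have "w' y (h *\<^sub>R e) = h *\<^sub>R w' y e" for h y
      using der[of y] by (simp add: has_derivative_def bounded_linear.linear linear_scale)
    ultimately show ?thesis by (simp add: has_vector_derivative_def)
  qed
  have "((\<lambda>s. integral (cbox (-c) c) (\<lambda>x. w (s *\<^sub>R e + x))) has_vector_derivative
      integral (cbox (-c) c) (\<lambda>x. w' (0 *\<^sub>R e + x) e)) (at 0 within {-1..1})"
  proof (rule leibniz_rule_vector_derivative)
    show "(\<lambda>x. w (s *\<^sub>R e + x)) integrable_on cbox (- c) c" for s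
      by (intro integrable_continuous continuous_on_compose2[OF contw] continuous_intros) auto
    have "continuous_on ({- 1..1} \<times> cbox (- c) c) (\<lambda>p. w' (fst p *\<^sub>R e + snd p) e)"
      by (rule continuous_on_compose2[OF cont]) (auto intro!: continuous_intros)
    then show "continuous_on ({- 1..1} \<times> cbox (- c) c) (\<lambda>(s, x). w' (s *\<^sub>R e + x) e)"
      by (simp add: split_beta)
  qed (auto intro: d)
  moreover have "((\<lambda>s. integral (cbox (-c) c) (\<lambda>x. w (s *\<^sub>R e + x))) has_vector_derivative 0)
      (at 0 within {-1..1})"
    by (rule has_vector_derivative_transform[of _ _ _ "\<lambda>s. integral (cbox a b) w"]) (auto simp: I)
  \<comment> \<open>Differentiation under the integral sign and constancy in \<open>s\<close> give
    two values for the same derivative at 0.\<close>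
  ultimately have "integral (cbox (-c) c) (\<lambda>x. w' x e) = 0"
    using vector_derivative_unique_within[of 0 "{-1..1}"] by (simp add: trivial_limit_within islimpt_Icc)
  moreover have "cbox a b \<subseteq> cbox (-c) c" using sub[of 0] by simp
  ultimately show ?thesis using integral_cbox_superset[of a b "-c" c "\<lambda>x. w' x e"] supp(2) by simp
qed

text \<open>Composing \<open>p\<close> with the transposition of \<open>k\<close> and
  \<open>r\<close> flips the sign, swaps the arguments of the symmetric \<open>D2\<close> and leaves
  the remaining product alone; hence the sum equals its own negative.\<close>

lemma sum_permutes_transpose_zero:
  fixes D2 :: "'m::finite \<Rightarrow> 'm \<Rightarrow> real" and D :: "'m \<Rightarrow> 'm \<Rightarrow> real"
  assumes "\<And>i j. D2 i j = D2 j i" and "r \<noteq> k"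
  shows "(\<Sum>p | p permutes UNIV. of_int (sign p) * (D2 (p r) (p k) * (\<Prod>i\<in>UNIV - {k} - {r}. D i (p i)))) = 0"
    (is "sum ?T ?P = 0")
proof -
  let ?t = "Transposition.transpose k r"
  have t: "?t permutes UNIV" by (rule permutes_swap_id) auto
  have "?T (p \<circ> ?t) = - ?T p" if "p \<in> ?P" for p
  proof -
    have "permutation p" "permutation ?t" using that t by (auto simp: permutation_permutes)
    then have "sign (p \<circ> ?t) = - sign p" using assms(2) by (simp add: sign_compose sign_swap_id)
    moreover have "(\<Prod>i\<in>UNIV - {k} - {r}. D i ((p \<circ> ?t) i)) = (\<Prod>i\<in>UNIV - {k} - {r}. D i (p i))"
      by (rule prod.cong) (auto simp: Transposition.transpose_def)
    ultimately show ?thesis using assms(1) by simp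
  qed
  then have "(\<Sum>p\<in>?P. ?T (p \<circ> ?t)) = - sum ?T ?P" by (simp add: sum_negf[symmetric])
  moreover have "sum ?T ?P = (\<Sum>p\<in>?P. ?T (p \<circ> ?t))"
    by (rule sum_permutations_compose_right[OF t])
  ultimately show ?thesis by linarith
qed

text \<open>The determinant of gradients is a null Lagrangian. For each permutation in the Leibniz
  formula, integration by parts moves the derivative from \<open>f\<close> to the product of the
  other rows; the second derivatives that arise cancel by antisymmetry.\<close>

lemma integral_det_compact_support:
  fixes g :: "'m::finite \<Rightarrow> real^'m \<Rightarrow> real" and f :: "real^'m \<Rightarrow> real"
  assumes g: "\<And>i. real_polynomial_function (g i)"
    and f: "\<And>x. (f has_derivative f' x) (at x)"
    and cont: "\<And>v. continuous_on UNIV (\<lambda>x. f' x v)"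
    and supp: "\<And>x. x \<notin> cbox a b \<Longrightarrow> f x = 0" "\<And>x v. x \<notin> cbox a b \<Longrightarrow> f' x v = 0"
  shows "((\<lambda>x. det (\<chi> i j. if i = k then f' x (axis j 1) else dirderiv (axis j 1) (g i) x))
    has_integral 0) (cbox a b)"
proof -
  define D where "D i j = dirderiv (axis j 1) (g i)" for i j
  define Q where "Q p x = (\<Prod>i\<in>UNIV - {k}. D i (p i) x)" for p x
  let ?P = "{p. p permutes (UNIV::'m set)}"
  have D: "real_polynomial_function (D i j)" for i j
    unfolding D_def by (intro real_polynomial_function_dirderiv g)
  have Q: "real_polynomial_function (Q p)" for p
    unfolding Q_def[abs_def] by (intro real_polynomial_function_prod D) auto
  have contf: "continuous_on S f" for S
    using f has_derivative_continuous by (meson continuous_at_imp_continuous_on)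
  note cQ = continuous_on_real_polynomial_function[OF Q]
    continuous_on_real_polynomial_function[OF real_polynomial_function_dirderiv[OF Q]]
  let ?v = "\<lambda>p. axis (p k) 1 :: real^'m"
  have int: "(\<lambda>x. f' x (?v p) * Q p x) integrable_on cbox a b"
    "(\<lambda>x. f x * dirderiv (?v p) (Q p) x) integrable_on cbox a b" for p
    by (intro integrable_continuous continuous_on_mult cQ contf continuous_on_subset[OF cont]; simp)+
  have parts: "integral (cbox a b) (\<lambda>x. f' x (?v p) * Q p x) =
      - integral (cbox a b) (\<lambda>x. f x * dirderiv (?v p) (Q p) x)" for p
  proof -
    let ?w = "\<lambda>x v. f x * dirderiv v (Q p) x + f' x v * Q p x"
    have "integral (cbox a b) (\<lambda>x. ?w x (?v p)) = 0"
    proof (rule integral_derivative_compact_support)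
      show "((\<lambda>x. f x * Q p x) has_derivative ?w x) (at x)" for x
        by (rule has_derivative_mult[OF f has_derivative_real_polynomial_function[OF Q]])
      show "continuous_on UNIV (\<lambda>x. ?w x (?v p))"
        by (intro continuous_on_add continuous_on_mult cQ contf cont)
    qed (use supp in auto)
    then show ?thesis using integral_add[OF int(2) int(1), of p] by simp
  qed
  \<comment> \<open>The cofactors of row \<open>k\<close> form a divergence-free field. Each term
    carries one second derivative of some \<open>g r\<close>, in the directions belonging to
    \<open>p r\<close> and \<open>p k\<close>.\<close>
  have zero: "(\<Sum>p\<in>?P. of_int (sign p) * dirderiv (?v p) (Q p) x) = 0" for x
  proof -
    have "dirderiv (?v p) (Q p) x = (\<Sum>r\<in>UNIV - {k}.
        dirderiv (?v p) (dirderiv (axis (p r) 1) (g r)) x * (\<Prod>i\<in>UNIV - {k} - {r}. D i (p i) x))" for p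
      unfolding Q_def[abs_def] by (subst dirderiv_prod) (auto simp: D_def g)
    then have "(\<Sum>p\<in>?P. of_int (sign p) * dirderiv (?v p) (Q p) x) =
      (\<Sum>r\<in>UNIV - {k}. \<Sum>p\<in>?P. of_int (sign p) *
        (dirderiv (?v p) (dirderiv (axis (p r) 1) (g r)) x * (\<Prod>i\<in>UNIV - {k} - {r}. D i (p i) x)))"
      by (subst sum.swap) (simp add: sum_distrib_left)
    also have "\<dots> = 0"
    proof (rule sum.neutral, rule ballI)
      fix r assume "r \<in> UNIV - {k}"
      then show "(\<Sum>p\<in>?P. of_int (sign p) *
        (dirderiv (?v p) (dirderiv (axis (p r) 1) (g r)) x * (\<Prod>i\<in>UNIV - {k} - {r}. D i (p i) x))) = 0"
        using sum_permutes_transpose_zero[of "\<lambda>i j. dirderiv (axis j 1) (dirderiv (axis i 1) (g r)) x"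
            r k "\<lambda>i j. D i j x"] dirderiv_commute[OF g] by auto
    qed
    finally show ?thesis .
  qed
  have det_eq: "det (\<chi> i j. if i = k then f' x (axis j 1) else dirderiv (axis j 1) (g i) x) =
      (\<Sum>p\<in>?P. of_int (sign p) * (f' x (?v p) * Q p x))" for x
  proof -
    have "(\<Prod>i\<in>UNIV. if i = k then f' x (axis (p i) 1) else dirderiv (axis (p i) 1) (g i) x) =
      f' x (?v p) * Q p x" for p
      by (subst prod.remove[of _ k]) (auto simp: Q_def D_def intro!: prod.cong)
    then show ?thesis by (simp add: det_def)
  qed
  then have "integral (cbox a b) (\<lambda>x. det (\<chi> i j. if i = k then f' x (axis j 1) else dirderiv (axis j 1) (g i) x))
    = (\<Sum>p\<in>?P. integral (cbox a b) (\<lambda>x. of_int (sign p) * (f' x (?v p) * Q p x)))"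
    by (simp add: integral_sum int)
  also have "\<dots> = - (\<Sum>p\<in>?P. integral (cbox a b) (\<lambda>x. of_int (sign p) * (f x * dirderiv (?v p) (Q p) x)))"
    by (simp add: parts sum_negf)
  also have "(\<Sum>p\<in>?P. integral (cbox a b) (\<lambda>x. of_int (sign p) * (f x * dirderiv (?v p) (Q p) x))) =
    integral (cbox a b) (\<lambda>x. \<Sum>p\<in>?P. of_int (sign p) * (f x * dirderiv (?v p) (Q p) x))"
    by (rule integral_sum[symmetric]) (auto simp: int)
  also have "(\<lambda>x. \<Sum>p\<in>?P. of_int (sign p) * (f x * dirderiv (?v p) (Q p) x)) = (\<lambda>x. 0)"
    using zero by (simp add: mult.left_commute[of _ "f _"] sum_distrib_left[symmetric])
  finally have "integral (cbox a b)
    (\<lambda>x. det (\<chi> i j. if i = k then f' x (axis j 1) else dirderiv (axis j 1) (g i) x)) = 0" by simp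
  moreover have "(\<lambda>x. det (\<chi> i j. if i = k then f' x (axis j 1) else dirderiv (axis j 1) (g i) x))
      integrable_on cbox a b"
    unfolding det_eq by (intro integrable_sum integrable_on_mult_right int) auto
  ultimately show ?thesis by (simp add: has_integral_iff)
qed

section \<open>Homotopy invariance of the degree integral\<close>

text \<open>By the Leibniz formula the determinant is a polynomial in its entries, and the product
  rule yields one determinant for each differentiated row.\<close>

lemma
  fixes M :: "'m::finite \<Rightarrow> 'm \<Rightarrow> 'a::real_normed_vector \<Rightarrow> real"
  assumes M: "\<And>i j. real_polynomial_function (M i j)"
  shows real_polynomial_function_det: "real_polynomial_function (\<lambda>z. det (\<chi> i j. M i j z))"
    and dirderiv_det: "dirderiv v (\<lambda>z. det (\<chi> i j. M i j z)) z =
      (\<Sum>k\<in>UNIV. det (\<chi> i j. if i = k then dirderiv v (M i j) z else M i j z))"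
proof -
  let ?P = "{p. p permutes (UNIV::'m set)}"
  let ?Q = "\<lambda>p z. \<Prod>i\<in>UNIV. M i (p i) z"
  have Q: "real_polynomial_function (?Q p)" for p
    by (intro real_polynomial_function_prod M) auto
  then have sQ: "real_polynomial_function (\<lambda>z. of_int (sign p) * ?Q p z)" for p
    by (intro real_polynomial_function.intros(2,4))
  have "real_polynomial_function (\<lambda>z. \<Sum>p\<in>?P. of_int (sign p) * ?Q p z)"
    by (intro real_polynomial_function_sum sQ) simp
  then show "real_polynomial_function (\<lambda>z. det (\<chi> i j. M i j z))"
    by (simp add: det_def)
  have "dirderiv v (\<lambda>z. of_int (sign p) * ?Q p z) z =
      of_int (sign p) * (\<Sum>k\<in>UNIV. dirderiv v (M k (p k)) z * (\<Prod>i\<in>UNIV - {k}. M i (p i) z))" for p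
    using dirderiv_mult[OF real_polynomial_function.intros(2) Q, of v "of_int (sign p)" p]
      dirderiv_prod[of UNIV "\<lambda>i. M i (p i)" v, OF M] by simp
  then have "dirderiv v (\<lambda>z. \<Sum>p\<in>?P. of_int (sign p) * ?Q p z) z =
    (\<Sum>p\<in>?P. \<Sum>k\<in>UNIV. of_int (sign p) * (dirderiv v (M k (p k)) z * (\<Prod>i\<in>UNIV - {k}. M i (p i) z)))"
    by (subst dirderiv_sum[OF sQ]) (simp add: sum_distrib_left)
  also have "\<dots> = (\<Sum>k\<in>UNIV. \<Sum>p\<in>?P.
      of_int (sign p) * (dirderiv v (M k (p k)) z * (\<Prod>i\<in>UNIV - {k}. M i (p i) z)))"
    by (rule sum.swap)
  also have "\<dots> = (\<Sum>k\<in>UNIV. det (\<chi> i j. if i = k then dirderiv v (M i j) z else M i j z))"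
  proof (rule sum.cong[OF refl])
    fix k
    have "(\<Prod>i\<in>UNIV. if i = k then dirderiv v (M i (p i)) z else M i (p i) z) =
      dirderiv v (M k (p k)) z * (\<Prod>i\<in>UNIV - {k}. M i (p i) z)" for p
      by (subst prod.remove[of _ k]) (auto intro!: prod.cong)
    then show "(\<Sum>p\<in>?P. of_int (sign p) * (dirderiv v (M k (p k)) z * (\<Prod>i\<in>UNIV - {k}. M i (p i) z))) =
      det (\<chi> i j. if i = k then dirderiv v (M i j) z else M i j z)"
      by (simp add: det_def)
  qed
  finally show "dirderiv v (\<lambda>z. det (\<chi> i j. M i j z)) z =
      (\<Sum>k\<in>UNIV. det (\<chi> i j. if i = k then dirderiv v (M i j) z else M i j z))"
    by (simp add: det_def)
qed

text \<open>By multilinearity in row \<open>k\<close>, the summands with \<open>l\<close> different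
  from \<open>k\<close> repeat a row and drop out. It serves to split off the gradient of the cutoff
  when that gradient is a combination of the rows of the Jacobian.\<close>

lemma det_row_combination:
  fixes M :: "real^'m^'m"
  shows "det (\<chi> i j. if i = k then s * u j + w * (\<Sum>l\<in>UNIV. \<beta> l * M $ l $ j) else M $ i $ j) =
    s * det (\<chi> i j. if i = k then u j else M $ i $ j) + w * \<beta> k * det M"
proof -
  have zero: "det (\<chi> i. if i = k then M $ l else M $ i) = (if l = k then det M else 0)" for l
  proof (cases "l = k")
    case True
    then have "(\<chi> i. if i = k then M $ l else M $ i) = M" by (auto simp: vec_eq_iff)
    with True show ?thesis by simp
  next
    case False
    have "det (\<chi> i. if i = k then M $ l else M $ i) = 0"
      by (rule det_identical_rows[OF False]) (use False in \<open>auto simp: row_def vec_eq_iff\<close>)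
    with False show ?thesis by simp
  qed
  have eq: "(\<chi> i j. if i = k then s * u j + w * (\<Sum>l\<in>UNIV. \<beta> l * M $ l $ j) else M $ i $ j) =
    (\<chi> i. if i = k then s *s (\<chi> j. u j) + (\<Sum>l\<in>UNIV. (w * \<beta> l) *s (M $ l)) else M $ i)"
    by (auto simp: vec_eq_iff sum_distrib_left mult.assoc)
  have eq2: "(\<chi> i j. if i = k then u j else M $ i $ j) = (\<chi> i. if i = k then (\<chi> j. u j) else M $ i)"
    by (auto simp: vec_eq_iff)
  show ?thesis
    unfolding eq eq2
    by (simp add: det_row_add det_linear_row_sum det_row_mul zero if_distrib[of "(*) _"] cong: if_cong)
qed

text \<open>The squared positive part is continuously differentiable, which suffices here because
  all second derivatives fall on polynomials. Applied to
  \<open>\<epsilon>\<^sup>2 - (norm y)\<^sup>2\<close> it gives a bump that vanishes outside the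
  ball of radius \<epsilon>.\<close>

definition bump :: "real \<Rightarrow> real" where
  "bump s = (max 0 s)\<^sup>2"

lemma bump_pos: "s > 0 \<Longrightarrow> bump s > 0"
  and bump_nonneg: "bump s \<ge> 0"
  and bump_eq_0: "s \<le> 0 \<Longrightarrow> bump s = 0"
  by (auto simp: bump_def)

lemma continuous_on_bump: "continuous_on S f \<Longrightarrow> continuous_on S (\<lambda>x. bump (f x))"
  unfolding bump_def by (intro continuous_intros)

lemma has_real_derivative_bump: "(bump has_real_derivative 2 * max 0 s) (at s)"
proof (cases "s = 0")
  case True
  \<comment> \<open>At the point where the two branches meet, the difference quotient is at most the
    absolute value of \<open>h\<close>.\<close>
  have "((\<lambda>h. (bump (0 + h) - bump 0) / h) \<longlongrightarrow> 0) (at 0)"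
  proof (rule Lim_null_comparison)
    show "\<forall>\<^sub>F h in at 0. norm ((bump (0 + h) - bump 0) / h) \<le> \<bar>h\<bar>"
      by (intro always_eventually allI)
        (auto simp: bump_def max_def power2_eq_square divide_simps)
    show "((\<lambda>h::real. \<bar>h\<bar>) \<longlongrightarrow> 0) (at 0)"
      by (rule tendsto_eq_intros | simp)+
  qed
  then show ?thesis using True by (simp add: DERIV_def)
next
  case False
  show ?thesis
  proof (cases "s > 0")
    case True
    have "((\<lambda>s. s\<^sup>2) has_real_derivative 2 * max 0 s) (at s)"
      using True by (auto intro!: derivative_eq_intros)
    then show ?thesis
      by (rule has_field_derivative_transform_within_open[of _ _ _ "{0<..}"])
        (use True in \<open>auto simp: bump_def\<close>)
  next
    case False
    have "((\<lambda>s. 0) has_real_derivative 2 * max 0 s) (at s)"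
      using False by simp
    then show ?thesis
      by (rule has_field_derivative_transform_within_open[of _ _ _ "{..<0}"])
        (use False \<open>s \<noteq> 0\<close> in \<open>auto simp: bump_def\<close>)
  qed
qed


lemma has_real_derivative_Pair:
  fixes f :: "real \<times> 'a::real_normed_vector \<Rightarrow> real"
  assumes "real_polynomial_function f"
  shows "((\<lambda>t. f (t, x)) has_real_derivative dirderiv (1, 0) f (t, x)) (at t within S)"
proof -
  have D: "(f has_derivative (\<lambda>v. dirderiv v f (t, x))) (at (t, x))"
    by (rule has_derivative_real_polynomial_function[OF assms])
  have "((\<lambda>t. f (t, x)) has_derivative (\<lambda>s. dirderiv (s, 0) f (t, x))) (at t within S)"
    by (rule has_derivative_compose[where f = "\<lambda>t. (t, x)" and g = f, OF _ D]) (auto intro!: derivative_eq_intros)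
  moreover have "dirderiv (s, 0) f (t, x) = dirderiv (1, 0) f (t, x) * s" for s
    using linear_scale[OF bounded_linear.linear[OF has_derivative_bounded_linear[OF D]], of s "(1, 0)"]
    by (simp add: mult.commute)
  then have "(\<lambda>s. dirderiv (s, 0) f (t, x)) = (*) (dirderiv (1, 0) f (t, x))"
    by (rule ext)
  ultimately show ?thesis by (simp only: has_field_derivative_def)
qed

text \<open>The \<open>t\<close>-derivative of the integrand is a sum over \<open>k\<close> of
  determinants, obtained from the Jacobian by replacing row \<open>k\<close> with the gradient of
  \<psi> times the \<open>t\<close>-derivative of the \<open>k\<close>-th component of
  \<open>H\<close>. Each of them integrates to zero. The lower bound on the frontier makes \<psi>
  vanish near it, so the cutoff at \<open>G\<close> does not spoil differentiability.\<close>

lemma integral_bump_jacobian_homotopy: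
  fixes H :: "real \<times> (real^'m::finite) \<Rightarrow> real^'m"
  assumes poly: "\<And>i. real_polynomial_function (\<lambda>z. H z $ i)"
    and G: "open G" "G \<subseteq> cbox a b"
    and "0 < \<epsilon>"
    and fr: "\<And>t x. t \<in> {0..1} \<Longrightarrow> x \<in> frontier G \<Longrightarrow> \<epsilon> < norm (H (t, x))"
  defines "J \<equiv> \<lambda>z. det (\<chi> i j. dirderiv (0, axis j 1) (\<lambda>z. H z $ i) z)"
    and "\<psi> \<equiv> \<lambda>z. if snd z \<in> G then bump (\<epsilon>\<^sup>2 - (norm (H z))\<^sup>2) else 0"
  shows "integral (cbox a b) (\<lambda>x. \<psi> (0, x) * J (0, x)) = integral (cbox a b) (\<lambda>x. \<psi> (1, x) * J (1, x))"
proof -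
  define R where "R z = \<epsilon>\<^sup>2 - (\<Sum>i\<in>UNIV. H z $ i * H z $ i)" for z
  \<comment> \<open>\<open>c\<close> is the square root of \<psi>. Its continuity gives that of
    \<psi> and also of the derivatives of \<psi>, which contain \<open>c\<close> as a
    factor.\<close>
  define c where "c z = (if snd z \<in> G then max 0 (R z) else 0)" for z
  define h where "h i = (\<lambda>z. H z $ i)" for i
  have h: "real_polynomial_function (h i)" for i unfolding h_def by (rule poly)
  have nH: "\<epsilon>\<^sup>2 - (norm (H z))\<^sup>2 = R z" for z
    by (simp add: R_def power2_norm_eq_inner inner_vec_def)
  have R: "real_polynomial_function R"
    unfolding R_def[abs_def]
    by (intro real_polynomial_function_diff real_polynomial_function.intros real_polynomial_function_sum
        poly) auto
  have dR: "dirderiv v R z = (\<Sum>i\<in>UNIV. - 2 * h i z * dirderiv v (h i) z)" for v z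
  proof -
    have "(R has_derivative (\<lambda>v. 0 - (\<Sum>i\<in>UNIV. H z $ i * dirderiv v (h i) z +
        dirderiv v (h i) z * H z $ i))) (at z)"
      unfolding R_def[abs_def] h_def
      by (intro has_derivative_diff has_derivative_const has_derivative_sum has_derivative_mult
          has_derivative_real_polynomial_function poly)
    then have "dirderiv v R z = 0 - (\<Sum>i\<in>UNIV. H z $ i * dirderiv v (h i) z +
        dirderiv v (h i) z * H z $ i)"
      by (rule dirderiv_eqI)
    then show ?thesis by (simp add: h_def sum_negf[symmetric] algebra_simps)
  qed
  have \<psi>_c: "\<psi> z = (c z)\<^sup>2" for z by (simp add: \<psi>_def c_def nH bump_def)
  have c_supp: "c z = 0" "\<psi> z = 0" if "snd z \<notin> G" for z using that by (auto simp: c_def \<psi>_c)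
  have frR: "R (t, x) < 0" if "t \<in> {0..1}" "x \<in> frontier G" for t x
    using power_strict_mono[OF fr[OF that], of 2] \<open>0 < \<epsilon>\<close> by (simp flip: nH)
  have contR: "continuous_on S R" for S by (rule continuous_on_real_polynomial_function[OF R])
  \<comment> \<open>Two closed pieces are glued. They overlap only over the frontier of
    \<open>G\<close>, where \<open>R\<close> is negative and both branches are zero.\<close>
  have contc: "continuous_on ({0..1} \<times> UNIV) c"
  proof -
    have "continuous_on ({0..1} \<times> closure G \<union> {0..1} \<times> (- G))
        (\<lambda>z. if snd z \<in> G then max 0 (R z) else 0)"
    proof (rule continuous_on_cases)
      show "\<forall>x::real \<times> (real^'m). x \<in> {0..1::real} \<times> closure G \<and> snd x \<notin> G \<or> x \<in> {0..1} \<times> (- G) \<and> snd x \<in> G \<longrightarrow> max 0 (R x) = 0"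
      proof (intro allI impI)
        fix x :: "real \<times> (real^'m)" assume "x \<in> {0..1} \<times> closure G \<and> snd x \<notin> G \<or> x \<in> {0..1} \<times> (- G) \<and> snd x \<in> G"
        then have "fst x \<in> {0..1}" "snd x \<in> frontier G"
          using G(1) by (auto simp: frontier_def interior_open)
        then show "max 0 (R x) = 0" using frR[of "fst x" "snd x"] by simp
      qed
    qed (use G(1) in \<open>auto intro!: closed_Times continuous_intros contR\<close>)
    moreover have "{0..1} \<times> closure G \<union> {0..1} \<times> (- G) = {0..1::real} \<times> UNIV"
      using closure_subset[of G] by auto
    ultimately show ?thesis by (simp add: c_def[abs_def])
  qed
  have cont\<psi>: "continuous_on ({0..1} \<times> UNIV) \<psi>"
    unfolding \<psi>_c[abs_def] by (intro continuous_intros contc)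
  have bumpR: "((\<lambda>z. bump (R z)) has_derivative (\<lambda>v. 2 * max 0 (R z) * dirderiv v R z)) (at z)" for z
    using has_derivative_compose[OF has_derivative_real_polynomial_function[OF R, of z]
        has_real_derivative_bump[unfolded has_field_derivative_def]] .
  \<comment> \<open>The factor -4 collects 2 from the derivative of \<open>bump\<close> and -2 from
    the derivative of \<open>R\<close>; thus the gradient of \<psi> is the combination of the
    gradients of the \<open>h i\<close> with coefficients \<open>\<alpha> i\<close>.\<close>
  define \<alpha> where "\<alpha> i z = - 4 * c z * h i z" for i z
  have \<alpha>_R: "2 * max 0 (R z) * dirderiv v R z = (\<Sum>i\<in>UNIV. \<alpha> i z * dirderiv v (h i) z)" if "snd z \<in> G" for v z
    using that by (simp add: \<alpha>_def c_def dR sum_distrib_left mult.assoc mult.left_commute)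
  have dx: "((\<lambda>x. \<psi> (t, x)) has_derivative (\<lambda>v. \<Sum>i\<in>UNIV. \<alpha> i (t, x) * dirderiv (0, v) (h i) (t, x))) (at x)"
    if t: "t \<in> {0..1}" for t x
  proof (cases "x \<in> G")
    case True
    have "((\<lambda>x. bump (R (t, x))) has_derivative
        (\<lambda>v. 2 * max 0 (R (t, x)) * dirderiv (0, v) R (t, x))) (at x)"
      by (rule has_derivative_compose[OF _ bumpR]) (auto intro!: derivative_eq_intros)
    then have "((\<lambda>x. bump (R (t, x))) has_derivative
        (\<lambda>v. \<Sum>i\<in>UNIV. \<alpha> i (t, x) * dirderiv (0, v) (h i) (t, x))) (at x)"
      using True by (simp add: \<alpha>_R)
    then show ?thesis
      by (rule has_derivative_transform_within_open[OF _ G(1) True]) (simp add: \<psi>_def nH)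
  next
    case False
    \<comment> \<open>On this open set \<open>\<psi> (t, _)\<close> is identically zero. It contains
      \<open>x\<close>: either \<open>x\<close> is off the closure of \<open>G\<close>, or
      \<open>x\<close> is on the frontier and \<open>R\<close> is negative there.\<close>
    let ?V = "{y. R (t, y) < 0} \<union> - closure G"
    have "continuous_on UNIV (\<lambda>y. R (t, y))"
      by (rule continuous_on_compose2[OF contR[of UNIV]]) (auto intro!: continuous_intros)
    then have V: "open ?V"
      by (intro open_Un open_Collect_less continuous_on_const) auto
    have x: "x \<in> ?V"
      using frR[OF t, of x] False G(1) by (auto simp: frontier_def interior_open)
    have z: "((\<lambda>x. 0) has_derivative (\<lambda>v. \<Sum>i\<in>UNIV. \<alpha> i (t, x) * dirderiv (0, v) (h i) (t, x))) (at x)"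
      using False by (simp add: \<alpha>_def c_supp)
    have "0 = \<psi> (t, y)" if "y \<in> ?V" for y
      using that closure_subset[of G] by (auto simp: \<psi>_def nH bump_eq_0)
    then show ?thesis by (rule has_derivative_transform_within_open[OF z V x])
  qed
  \<comment> \<open>Here \<open>x\<close> is fixed, so membership in \<open>G\<close> does not
    change with \<open>t\<close> and the frontier causes no trouble.\<close>
  have dt: "((\<lambda>t. \<psi> (t, x)) has_real_derivative (\<Sum>i\<in>UNIV. \<alpha> i (t, x) * dirderiv (1, 0) (h i) (t, x)))
      (at t within S)" for t x S
  proof (cases "x \<in> G")
    case True
    have "((\<lambda>t. bump (R (t, x))) has_real_derivative
        2 * max 0 (R (t, x)) * dirderiv (1, 0) R (t, x)) (at t within S)"
      by (rule DERIV_chain'[OF has_real_derivative_Pair[OF R] has_real_derivative_bump])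
    then show ?thesis using True by (simp add: \<alpha>_R \<psi>_def nH)
  next
    case False
    then show ?thesis by (simp add: \<psi>_c c_supp \<alpha>_def)
  qed
  have J_def': "J = (\<lambda>z. det (\<chi> i j. dirderiv (0, axis j 1) (h i) z))"
    by (simp add: J_def h_def)
  have Jp: "real_polynomial_function J"
    unfolding J_def' by (intro real_polynomial_function_det real_polynomial_function_dirderiv h)
  define g where "g k = dirderiv (1, 0) (h k)" for k
  have g: "real_polynomial_function (g k)" for k
    unfolding g_def by (intro real_polynomial_function_dirderiv h)
  \<comment> \<open>Since the \<open>t\<close>-derivative commutes with the space derivatives, the
    differentiated row \<open>k\<close> is the space gradient of \<open>g k\<close>.\<close>
  have dJ: "dirderiv (1, 0) J z = (\<Sum>k\<in>UNIV. det (\<chi> i j. if i = k then dirderiv (0, axis j 1) (g k) z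
      else dirderiv (0, axis j 1) (h i) z))" for z
    unfolding J_def'
    by (subst dirderiv_det) (auto simp: h g_def dirderiv_commute[OF h, of "(1, 0)"] intro!: sum.cong arg_cong[of _ _ det] simp: vec_eq_iff)
  define \<Phi> where "\<Phi> z = (\<Sum>i\<in>UNIV. \<alpha> i z * g i z) * J z + \<psi> z * dirderiv (1, 0) J z" for z
  note cont_poly = continuous_on_real_polynomial_function
  have dI: "((\<lambda>t. \<psi> (t, x) * J (t, x)) has_vector_derivative \<Phi> (t, x)) (at t within {0..1})" for t x
  proof -
    from DERIV_mult[OF dt has_real_derivative_Pair[OF Jp]] show ?thesis
      unfolding has_real_derivative_iff_has_vector_derivative[symmetric]
      by (simp add: \<Phi>_def g_def mult.commute add.commute)
  qed
  have cont\<Phi>: "continuous_on ({0..1} \<times> UNIV) \<Phi>"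
    unfolding \<Phi>_def[abs_def] \<alpha>_def
    by (intro continuous_intros contc cont\<psi> cont_poly h g Jp real_polynomial_function_dirderiv)
  have zero: "integral (cbox a b) (\<lambda>x. \<Phi> (t, x)) = 0" if t: "t \<in> {0..1}" for t
  proof -
    let ?f' = "\<lambda>k x v. \<psi> (t, x) * dirderiv (0, v) (g k) (t, x) +
      (\<Sum>i\<in>UNIV. \<alpha> i (t, x) * dirderiv (0, v) (h i) (t, x)) * g k (t, x)"
    have slice: "continuous_on S (\<lambda>x. u (t, x))"
      if "continuous_on ({0..1} \<times> UNIV) u" for u :: "real \<times> (real^'m) \<Rightarrow> real" and S
      by (rule continuous_on_compose2[OF that]) (use t in \<open>auto intro!: continuous_intros\<close>)
    have supp: "c (t, x) = 0" "\<psi> (t, x) = 0" if "x \<notin> cbox a b" for x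
      using that G(2) c_supp[of "(t, x)"] by auto
    have "((\<lambda>x. det (\<chi> i j. if i = k then ?f' k x (axis j 1)
        else dirderiv (axis j 1) (\<lambda>x. h i (t, x)) x)) has_integral 0) (cbox a b)" for k
    proof (rule integral_det_compact_support)
      show "((\<lambda>x. \<psi> (t, x) * g k (t, x)) has_derivative ?f' k x) (at x)" for x
      proof (rule has_derivative_mult[OF dx[OF t]])
        show "((\<lambda>x. g k (t, x)) has_derivative (\<lambda>v. dirderiv (0, v) (g k) (t, x))) (at x)"
          by (rule has_derivative_compose[OF _ has_derivative_real_polynomial_function[OF g]])
            (auto intro!: derivative_eq_intros)
      qed
      show "continuous_on UNIV (\<lambda>x. ?f' k x v)" for v
        unfolding \<alpha>_def
        by (rule slice, intro continuous_intros contc cont\<psi> cont_poly h g real_polynomial_function_dirderiv)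
    qed (auto simp: \<alpha>_def supp intro!: real_polynomial_function_Pair h)
    then have "((\<lambda>x. \<Sum>k\<in>UNIV. det (\<chi> i j. if i = k then ?f' k x (axis j 1)
        else dirderiv (axis j 1) (\<lambda>x. h i (t, x)) x)) has_integral (\<Sum>k\<in>(UNIV::'m set). 0)) (cbox a b)"
      by (intro has_integral_sum) auto
    \<comment> \<open>In row \<open>k\<close> the product rule puts \<psi> times the gradient of
      \<open>g k\<close> plus \<open>g k\<close> times the gradient of \<psi>; of the latter only
      the part along row \<open>k\<close> survives.\<close>
    moreover have "(\<Sum>k\<in>UNIV. det (\<chi> i j. if i = k then ?f' k x (axis j 1)
        else dirderiv (axis j 1) (\<lambda>x. h i (t, x)) x)) = \<Phi> (t, x)" for x
    proof -
      let ?M = "\<chi> i j. dirderiv (0, axis j 1) (h i) (t, x)"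
      have "det (\<chi> i j. if i = k then ?f' k x (axis j 1) else dirderiv (axis j 1) (\<lambda>x. h i (t, x)) x) =
        \<psi> (t, x) * det (\<chi> i j. if i = k then dirderiv (0, axis j 1) (g k) (t, x)
          else dirderiv (0, axis j 1) (h i) (t, x)) + g k (t, x) * \<alpha> k (t, x) * J (t, x)" for k
        using det_row_combination[of k "\<psi> (t, x)" "\<lambda>j. dirderiv (0, axis j 1) (g k) (t, x)" "g k (t, x)"
            "\<lambda>i. \<alpha> i (t, x)" ?M]
        by (simp add: J_def' dirderiv_Pair[OF h] mult.commute cong: if_cong)
      then show ?thesis
        by (simp add: \<Phi>_def dJ sum.distrib sum_distrib_left sum_distrib_right mult.commute mult.left_commute)
    qed
    ultimately show ?thesis by (simp add: has_integral_iff)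
  qed
  let ?I = "\<lambda>t. integral (cbox a b) (\<lambda>x. \<psi> (t, x) * J (t, x))"
  have "(?I has_vector_derivative 0) (at t within {0..1})" if t: "t \<in> {0..1}" for t
  proof -
    have "(?I has_vector_derivative integral (cbox a b) (\<lambda>x. \<Phi> (t, x))) (at t within {0..1})"
    proof (rule leibniz_rule_vector_derivative)
      show "(\<lambda>x. \<psi> (t, x) * J (t, x)) integrable_on cbox a b" if "t \<in> {0..1}" for t
      proof (rule integrable_continuous)
        have "continuous_on ({0..1} \<times> UNIV) (\<lambda>z. \<psi> z * J z)"
          by (intro continuous_intros cont\<psi> cont_poly Jp)
        then show "continuous_on (cbox a b) (\<lambda>x. \<psi> (t, x) * J (t, x))"
          by (rule continuous_on_compose2) (use that in \<open>auto intro!: continuous_intros\<close>)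
      qed
      show "continuous_on ({0..1} \<times> cbox a b) (\<lambda>(t, x). \<Phi> (t, x))"
        using continuous_on_subset[OF cont\<Phi>] by simp blast
    qed (use t dI in auto)
    then show ?thesis using zero[OF t] by simp
  qed
  then obtain d where "\<And>t. t \<in> {0..1} \<Longrightarrow> ?I t = d"
    using has_vector_derivative_zero_constant[OF convex_real_interval(5), of 0 1 ?I] by blast
  then show ?thesis by simp
qed

section \<open>Counting regular zeros\<close>

definition jacobian :: "(real^'m::finite \<Rightarrow> real^'m) \<Rightarrow> real^'m \<Rightarrow> real^'m^'m" where
  "jacobian F x = (\<chi> i j. dirderiv (axis j 1) (\<lambda>x. F x $ i) x)"

lemma has_derivative_jacobian:
  assumes "\<And>i. real_polynomial_function (\<lambda>x. F x $ i)"
  shows "(F has_derivative (*v) (jacobian F x)) (at x)"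
proof -
  have "((\<lambda>x. F x $ k) has_derivative (\<lambda>v. (jacobian F x *v v) $ k)) (at x)" for k
  proof -
    let ?L = "\<lambda>v. dirderiv v (\<lambda>x. F x $ k) x"
    have D: "((\<lambda>x. F x $ k) has_derivative ?L) (at x)"
      by (rule has_derivative_real_polynomial_function[OF assms])
    then have lin: "linear ?L" by (simp add: has_derivative_bounded_linear bounded_linear.linear)
    have "?L v = (jacobian F x *v v) $ k" for v
    proof -
      have "?L v = ?L (\<Sum>j\<in>UNIV. v $ j *\<^sub>R axis j 1)"
        using basis_expansion[of v] by (simp add: scalar_mult_eq_scaleR)
      also have "\<dots> = (\<Sum>j\<in>UNIV. v $ j *\<^sub>R ?L (axis j 1))"
        by (simp only: linear_sum[OF lin] linear_scale[OF lin])
      finally show ?thesis by (simp add: matrix_vector_mult_def jacobian_def mult.commute)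
    qed
    then show ?thesis using D by simp
  qed
  then show ?thesis
    by (subst has_derivative_componentwise_within) (auto simp: Basis_vec_def inner_axis)
qed

lemma jacobian_eqI:
  assumes "\<And>i. real_polynomial_function (\<lambda>x. F x $ i)" "(F has_derivative (*v) A) (at x)"
  shows "jacobian F x = A"
proof -
  have "(*v) (jacobian F x) = (*v) A"
    by (rule has_derivative_unique[OF has_derivative_jacobian[OF assms(1)] assms(2)])
  then show ?thesis by (simp add: matrix_eq fun_eq_iff)
qed

section \<open>Integrals of bumps and the change of variables\<close>

lemma integral_eq_UNIV:
  fixes f :: "'a::euclidean_space \<Rightarrow> 'b::banach"
  assumes "\<And>x. x \<notin> S \<Longrightarrow> f x = 0"
  shows "integral S f = integral UNIV f"
proof -
  have "(\<lambda>x. if x \<in> S then f x else 0) = f" using assms by auto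
  then show ?thesis by (metis integral_restrict_UNIV)
qed

lemma absolutely_integrable_compact_support:
  fixes f :: "'a::euclidean_space \<Rightarrow> real"
  assumes "continuous_on (cbox a b) f" "\<And>x. x \<notin> cbox a b \<Longrightarrow> f x = 0"
  shows "f absolutely_integrable_on UNIV"
proof -
  have "(\<lambda>x. if x \<in> cbox a b then f x else 0) = f" using assms(2) by auto
  then show ?thesis
    using absolutely_integrable_continuous[OF assms(1)] absolutely_integrable_restrict_UNIV by metis
qed

lemma absolutely_integrable_bump:
  fixes \<epsilon> :: real
  shows "(\<lambda>y::'a::euclidean_space. bump (\<epsilon>\<^sup>2 - (norm y)\<^sup>2)) absolutely_integrable_on UNIV"
proof -
  obtain u where u: "cball 0 \<bar>\<epsilon>\<bar> \<subseteq> cbox (-u) (u::'a)"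
    using bounded_subset_cbox_symmetric[OF bounded_cball] by metis
  show ?thesis
  proof (rule absolutely_integrable_compact_support)
    show "continuous_on (cbox (-u) u) (\<lambda>y. bump (\<epsilon>\<^sup>2 - (norm y)\<^sup>2))"
      by (intro continuous_on_bump continuous_intros)
    fix y assume "y \<notin> cbox (-u) u"
    then have "y \<notin> cball 0 \<bar>\<epsilon>\<bar>" using u by blast
    then have "\<bar>\<epsilon>\<bar> < norm y" by simp
    then have "\<bar>\<epsilon>\<bar>\<^sup>2 < (norm y)\<^sup>2" by (intro power_strict_mono) auto
    then show "bump (\<epsilon>\<^sup>2 - (norm y)\<^sup>2) = 0" by (simp add: bump_eq_0)
  qed
qed

lemma integral_bump_pos:
  assumes "\<epsilon> \<noteq> 0"
  shows "0 < integral UNIV (\<lambda>y::'a::euclidean_space. bump (\<epsilon>\<^sup>2 - (norm y)\<^sup>2))"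
proof -
  let ?f = "\<lambda>y::'a. bump (\<epsilon>\<^sup>2 - (norm y)\<^sup>2)"
  have int: "?f integrable_on UNIV"
    using absolutely_integrable_bump by (rule set_lebesgue_integral_eq_integral)
  let ?One = "One :: 'a"
  have box: "box (-?One) ?One \<noteq> {}" "0 \<in> cbox (-?One) ?One"
    by (auto simp: box_ne_empty mem_box)
  have cont: "continuous_on (cbox (-?One) ?One) ?f"
    by (intro continuous_on_bump continuous_intros)
  have "?f 0 \<noteq> 0" using bump_pos[of "\<epsilon>\<^sup>2"] assms by auto
  then have "integral (cbox (-?One) ?One) ?f \<noteq> 0"
    using integral_cbox_eq_0_iff[OF cont box(1)] box(2) bump_nonneg by blast
  moreover have "0 \<le> integral (cbox (-?One) ?One) ?f"
    by (intro integral_nonneg integrable_continuous cont) (auto simp: bump_nonneg)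
  moreover have "integral (cbox (-?One) ?One) ?f \<le> integral UNIV ?f"
    by (intro integral_subset_le integrable_continuous cont int) (auto simp: bump_nonneg)
  ultimately show ?thesis by linarith
qed

text \<open>Substituting \<open>F x\<close> for \<open>y\<close> recovers the whole integral of the
  bump, because the image of \<open>N\<close> contains the ball outside which the bump
  vanishes.\<close>

lemma has_integral_bump_diffeo:
  fixes F :: "real^'m::{finite,wellorder} \<Rightarrow> real^'m::_"
  assumes der: "\<And>x. x \<in> N \<Longrightarrow> (F has_derivative (*v) (A x)) (at x)"
    and N: "open N" "inj_on F N"
    and im: "ball 0 \<epsilon> \<subseteq> F ` N" and "0 < \<epsilon>"
  shows "((\<lambda>x. bump (\<epsilon>\<^sup>2 - (norm (F x))\<^sup>2) * \<bar>det (A x)\<bar>) has_integral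
    integral UNIV (\<lambda>y::real^'m::_. bump (\<epsilon>\<^sup>2 - (norm y)\<^sup>2))) N"
proof -
  let ?f = "\<lambda>y::real^'m::_. bump (\<epsilon>\<^sup>2 - (norm y)\<^sup>2)"
  \<comment> \<open>The change-of-variables theorem treats vector-valued integrands, so the scalar
    bump is wrapped as a vector with one component.\<close>
  let ?v = "\<lambda>y::real^'m::_. vec (?f y) :: real^1"
  have cont: "continuous_on N F"
    using der has_derivative_continuous by (meson continuous_at_imp_continuous_on)
  have S: "F ` N \<in> sets lebesgue"
    using invariance_of_domain[OF cont N] by (simp add: borel_open)
  have sub: "?f absolutely_integrable_on F ` N"
    by (rule set_integrable_subset[OF absolutely_integrable_bump S]) auto
  have "?f y = 0" if "y \<notin> F ` N" for y
  proof -
    have "y \<notin> ball 0 \<epsilon>" using im that by blast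
    then have "\<epsilon>\<^sup>2 \<le> (norm y)\<^sup>2" using \<open>0 < \<epsilon>\<close> by (intro power_mono) auto
    then show ?thesis by (simp add: bump_eq_0)
  qed
  then have "integral (F ` N) ?f = integral UNIV ?f" by (rule integral_eq_UNIV)
  then have "?v absolutely_integrable_on F ` N \<and> integral (F ` N) ?v = vec (integral UNIV ?f)"
    using sub by (simp add: absolutely_integrable_on_1_iff integral_on_1_eq)
  then have "(\<lambda>x. \<bar>det (matrix ((*v) (A x)))\<bar> *\<^sub>R ?v (F x)) absolutely_integrable_on N \<and>
     integral N (\<lambda>x. \<bar>det (matrix ((*v) (A x)))\<bar> *\<^sub>R ?v (F x)) = vec (integral UNIV ?f)"
    by (subst has_absolute_integral_change_of_variables[OF _ _ N(2)])
      (use N(1) der in \<open>auto simp: borel_open intro: has_derivative_at_withinI\<close>)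
  then have "(\<lambda>x. \<bar>det (A x)\<bar> * ?f (F x)) absolutely_integrable_on N"
    "integral N (\<lambda>x. \<bar>det (A x)\<bar> * ?f (F x)) = integral UNIV ?f"
    by (auto simp: absolutely_integrable_on_1_iff integral_on_1_eq)
  then show ?thesis
    by (auto simp: has_integral_iff mult.commute dest: set_lebesgue_integral_eq_integral)
qed

text \<open>The derivative at \<open>a\<close> is invertible and depends continuously on the point
  in operator norm, which forces local injectivity; continuity of the determinant keeps its
  sign.\<close>

lemma locally_injective_jacobian:
  fixes F :: "real^'m::finite \<Rightarrow> real^'m"
  assumes poly: "\<And>i. real_polynomial_function (\<lambda>x. F x $ i)"
    and det: "det (jacobian F a) \<noteq> 0" and "open S" "a \<in> S"
  shows "\<exists>r>0. ball a r \<subseteq> S \<and> inj_on F (ball a r) \<and>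
    (\<forall>x\<in>ball a r. sgn (det (jacobian F x)) = sgn (det (jacobian F a)))"
proof -
  have cJ: "continuous_on UNIV (\<lambda>x. jacobian F x $ i $ j)" for i j
    unfolding jacobian_def
    by (simp, intro continuous_on_real_polynomial_function real_polynomial_function_dirderiv poly)
  obtain B where B: "B ** jacobian F a = mat 1"
    using det by (auto simp: invertible_det_nz[symmetric] invertible_def)
  obtain r where r: "0 < r" "ball a r \<subseteq> S" "inj_on F (ball a r)"
  proof (rule has_derivative_locally_injective[OF \<open>a \<in> S\<close> \<open>open S\<close>, of "(*v) B" "\<lambda>x. (*v) (jacobian F x)" F])
    show "bounded_linear ((*v) B)" by (rule matrix_vector_mul_bounded_linear)
    show "(*v) B \<circ> (*v) (jacobian F a) = id"
      by (simp add: fun_eq_iff matrix_vector_mul_assoc B)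
    fix e :: real assume "0 < e"
    \<comment> \<open>The entrywise sum is continuous, vanishes at \<open>a\<close> and dominates
      the operator norm of the difference of the two Jacobians.\<close>
    let ?s = "\<lambda>x. \<Sum>i\<in>UNIV. \<Sum>j\<in>UNIV. \<bar>jacobian F x $ i $ j - jacobian F a $ i $ j\<bar>"
    have "continuous_on UNIV ?s" by (intro continuous_intros cJ)
    then have "open {x. ?s x < e}" by (intro open_Collect_less continuous_on_const)
    moreover have "a \<in> {x. ?s x < e}" using \<open>0 < e\<close> by simp
    ultimately obtain d where "0 < d" "ball a d \<subseteq> {x. ?s x < e}" by (meson openE)
    moreover have "onorm (\<lambda>v. jacobian F x *v v - jacobian F a *v v) \<le> ?s x" for x
    proof -
      have "(\<lambda>v. jacobian F x *v v - jacobian F a *v v) = (*v) (jacobian F x - jacobian F a)"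
        by (simp add: fun_eq_iff matrix_vector_mult_diff_rdistrib)
      then show ?thesis using onorm_le_matrix_component_sum[of "jacobian F x - jacobian F a"] by simp
    qed
    ultimately show "\<exists>d>0. \<forall>x. dist a x < d \<longrightarrow> onorm (\<lambda>v. jacobian F x *v v - jacobian F a *v v) < e"
      by (intro exI[of _ d]) (force intro: le_less_trans simp: subset_iff)
  qed (auto intro: has_derivative_jacobian poly)
  have "continuous_on UNIV (\<lambda>x. det (jacobian F x) * det (jacobian F a))"
    unfolding det_def by (intro continuous_intros cJ)
  then have "open {x. 0 < det (jacobian F x) * det (jacobian F a)}"
    by (intro open_Collect_less continuous_on_const)
  moreover have "a \<in> {x. 0 < det (jacobian F x) * det (jacobian F a)}"
    using det by (simp add: zero_less_mult_iff) linarith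
  ultimately obtain q where q: "0 < q" "ball a q \<subseteq> {x. 0 < det (jacobian F x) * det (jacobian F a)}"
    by (meson openE)
  show ?thesis
  proof (intro exI[of _ "min r q"] conjI ballI)
    show "inj_on F (ball a (min r q))" by (rule inj_on_subset[OF r(3)]) auto
    fix x assume "x \<in> ball a (min r q)"
    then have "0 < det (jacobian F x) * det (jacobian F a)" using q by auto
    then show "sgn (det (jacobian F x)) = sgn (det (jacobian F a))"
      by (auto simp: zero_less_mult_iff)
  qed (use r q in auto)
qed

text \<open>The zeros in \<open>G\<close> are isolated by local injectivity and form a compact set
  because none lies on the frontier; so they are finitely many. For small \<epsilon> the bump lives
  on disjoint neighbourhoods of the zeros, and each contributes the integral of the bump times the
  sign of its determinant.\<close>

lemma
  fixes F :: "real^'m::{finite,wellorder} \<Rightarrow> real^'m::_"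
  assumes poly: "\<And>i. real_polynomial_function (\<lambda>x. F x $ i)"
    and G: "open G" "bounded G"
    and fr: "\<And>x. x \<in> frontier G \<Longrightarrow> F x \<noteq> 0"
    and reg: "\<And>x. x \<in> G \<Longrightarrow> F x = 0 \<Longrightarrow> det (jacobian F x) \<noteq> 0"
  shows finite_regular_zeros: "finite {x \<in> G. F x = 0}"
    and eventually_integral_bump_jacobian:
      "\<forall>\<^sub>F \<epsilon> in at_right 0.
        ((\<lambda>x. (if x \<in> G then bump (\<epsilon>\<^sup>2 - (norm (F x))\<^sup>2) else 0) * det (jacobian F x)) has_integral
          integral UNIV (\<lambda>y::real^'m::_. bump (\<epsilon>\<^sup>2 - (norm y)\<^sup>2)) *
          (\<Sum>x | x \<in> G \<and> F x = 0. sgn (det (jacobian F x)))) UNIV"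
proof -
  let ?Z = "{x \<in> G. F x = 0}"
  have cont: "continuous_on S F" for S
    using has_derivative_jacobian[OF poly] has_derivative_continuous
    by (meson continuous_at_imp_continuous_on)
  have clG: "x \<in> G" if "x \<in> closure G" "F x = 0" for x
    using that fr[of x] G(1) by (auto simp: frontier_def interior_open)
  let ?loc = "\<lambda>z r. 0 < r \<and> ball z r \<subseteq> G \<and> inj_on F (ball z r) \<and>
      (\<forall>x\<in>ball z r. sgn (det (jacobian F x)) = sgn (det (jacobian F z)))"
  have "\<forall>z\<in>?Z. \<exists>r. ?loc z r"
  proof
    fix z assume "z \<in> ?Z"
    then have "det (jacobian F z) \<noteq> 0" "z \<in> G" using reg[of z] by auto
    then show "\<exists>r. ?loc z r" by (rule locally_injective_jacobian[OF poly _ G(1)])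
  qed
  from bchoice[OF this] obtain r where R: "\<forall>z\<in>?Z. ?loc z (r z)" ..
  note r = bspec[OF R, THEN conjunct1] bspec[OF R, THEN conjunct2, THEN conjunct1]
    bspec[OF R, THEN conjunct2, THEN conjunct2, THEN conjunct1]
    bspec[OF bspec[OF R, THEN conjunct2, THEN conjunct2, THEN conjunct2]]
  have iso: "z = z'" if "z \<in> ?Z" "z' \<in> ?Z" "dist z z' < r z" for z z'
    using inj_onD[OF r(3)[OF that(1)], of z z'] that r(1)[OF that(1)] by simp
  have "?Z = closure G \<inter> {x. F x = 0}" using clG closure_subset by auto
  moreover have "closed {x. F x = 0}" by (intro closed_Collect_eq cont continuous_on_const)
  ultimately have "closed ?Z" by (simp add: closed_Int)
  then have compZ: "compact ?Z" using G(2) by (simp add: compact_eq_bounded_closed bounded_subset)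
  show fin: "finite ?Z"
  proof (rule ccontr)
    assume "infinite ?Z"
    then obtain z where z: "z \<in> ?Z" "z islimpt ?Z"
      using compZ by (auto simp: compact_eq_Bolzano_Weierstrass)
    then obtain z' where "z' \<in> ?Z" "z' \<noteq> z" "dist z' z < r z"
      using r(1)[OF z(1)] by (auto simp: islimpt_approachable)
    then show False using iso[OF z(1)] by (metis dist_commute)
  qed
  \<comment> \<open>Halving the radii makes the balls disjoint: if two of them met, one centre would
    lie in the injectivity ball of the other.\<close>
  define N where "N z = ball z (r z / 2)" for z
  have N: "open (N z)" for z by (simp add: N_def)
  have zN: "z \<in> N z" "N z \<subseteq> ball z (r z)" if "z \<in> ?Z" for z
    using r(1)[OF that] by (auto simp: N_def)
  have disj: "N z \<inter> N z' = {}" if "z \<in> ?Z" "z' \<in> ?Z" "z \<noteq> z'" for z z'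
  proof (rule ccontr)
    assume "N z \<inter> N z' \<noteq> {}"
    then obtain x where x: "dist z x < r z / 2" "dist z' x < r z' / 2" by (auto simp: N_def)
    then have "dist z z' < r z / 2 + r z' / 2"
      using dist_triangle2[of z z' x] by linarith
    then have "dist z z' < r z \<or> dist z' z < r z'" by (simp add: dist_commute) linarith
    then show False using iso[OF that(1,2)] iso[OF that(2,1)] that(3) by blast
  qed
  have injN: "inj_on F (N z)" if "z \<in> ?Z" for z
    by (rule inj_on_subset[OF r(3) zN(2)]) (use that in auto)
  let ?K = "closure G - (\<Union>z\<in>?Z. N z)"
  have "compact (F ` ?K)"
    by (intro compact_continuous_image cont compact_diff open_UN) (auto simp: N G(2))
  moreover have "0 \<notin> F ` ?K" using clG zN(1) by force
  ultimately have "open (- (F ` ?K))" "0 \<in> - (F ` ?K)" by (auto intro: compact_imp_closed)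
  moreover have "open (F ` N z)" "0 \<in> F ` N z" if "z \<in> ?Z" for z
    using that zN(1)[OF that] invariance_of_domain[OF cont N injN[OF that]] by (auto intro: image_eqI[of _ _ z])
  ultimately have "open (- (F ` ?K) \<inter> (\<Inter>z\<in>?Z. F ` N z))" "0 \<in> - (F ` ?K) \<inter> (\<Inter>z\<in>?Z. F ` N z)"
    using fin by (auto intro!: open_Int open_INT)
  then obtain \<epsilon>0 where \<epsilon>0: "0 < \<epsilon>0" "ball 0 \<epsilon>0 \<subseteq> - (F ` ?K) \<inter> (\<Inter>z\<in>?Z. F ` N z)"
    by (meson openE)
  show "\<forall>\<^sub>F \<epsilon> in at_right 0.
        ((\<lambda>x. (if x \<in> G then bump (\<epsilon>\<^sup>2 - (norm (F x))\<^sup>2) else 0) * det (jacobian F x)) has_integral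
          integral UNIV (\<lambda>y::real^'m::_. bump (\<epsilon>\<^sup>2 - (norm y)\<^sup>2)) *
          (\<Sum>x | x \<in> G \<and> F x = 0. sgn (det (jacobian F x)))) UNIV"
    unfolding eventually_at_right_field
  proof (intro exI[of _ \<epsilon>0] conjI allI impI)
    fix \<epsilon> :: real assume \<epsilon>: "0 < \<epsilon>" "\<epsilon> < \<epsilon>0"
    let ?C = "integral UNIV (\<lambda>y::real^'m::_. bump (\<epsilon>\<^sup>2 - (norm y)\<^sup>2))"
    let ?u = "\<lambda>x. (if x \<in> G then bump (\<epsilon>\<^sup>2 - (norm (F x))\<^sup>2) else 0) * det (jacobian F x)"
    have "(?u has_integral (?C * sgn (det (jacobian F z)))) (N z)" if z: "z \<in> ?Z" for z
    proof -
      have "ball 0 \<epsilon> \<subseteq> F ` N z" using \<epsilon>0(2) \<epsilon> z by (auto simp: subset_iff)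
      from has_integral_bump_diffeo[OF has_derivative_jacobian[OF poly] N injN[OF z] this \<epsilon>(1)]
      \<comment> \<open>The sign of the determinant is constant on \<open>N z\<close>, so
        multiplying by its value at \<open>z\<close> removes the absolute value.\<close>
      have "((\<lambda>x. bump (\<epsilon>\<^sup>2 - (norm (F x))\<^sup>2) * \<bar>det (jacobian F x)\<bar> * sgn (det (jacobian F z)))
          has_integral (?C * sgn (det (jacobian F z)))) (N z)"
        by (rule has_integral_mult_left)
      then show ?thesis
      proof (rule has_integral_eq[rotated])
        fix x assume "x \<in> N z"
        then have "x \<in> G" "sgn (det (jacobian F z)) = sgn (det (jacobian F x))"
          using zN(2)[OF z] r(2,4)[OF z] by auto
        then show "bump (\<epsilon>\<^sup>2 - (norm (F x))\<^sup>2) * \<bar>det (jacobian F x)\<bar> * sgn (det (jacobian F z)) = ?u x"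
          by (simp add: abs_mult_sgn)
      qed
    qed
    then have has: "(?u has_integral (\<Sum>z\<in>?Z. ?C * sgn (det (jacobian F z)))) (\<Union>z\<in>?Z. N z)"
      using disj by (intro has_integral_UN fin) (auto simp: pairwise_def)
    have zero: "?u x = 0" if "x \<notin> (\<Union>z\<in>?Z. N z)" for x
    proof (cases "x \<in> G")
      case True
      then have "F x \<in> F ` ?K" using that closure_subset[of G] by blast
      then have "F x \<notin> ball 0 \<epsilon>0" using \<epsilon>0(2) by blast
      then have "\<epsilon>\<^sup>2 \<le> (norm (F x))\<^sup>2" using \<epsilon> by (intro power_mono) auto
      then show ?thesis by (simp add: bump_eq_0)
    qed simp
    show "(?u has_integral ?C * (\<Sum>z\<in>?Z. sgn (det (jacobian F z)))) UNIV"
      unfolding sum_distrib_left by (rule has_integral_on_superset[OF has zero subset_UNIV])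
  qed (rule \<epsilon>0(1))
qed

text \<open>Each sign is 1 or -1, hence congruent to 1 modulo 2.\<close>

lemma sum_sgn_parity:
  fixes f :: "'a \<Rightarrow> real"
  assumes "finite Z" "\<And>z. z \<in> Z \<Longrightarrow> f z \<noteq> 0"
  shows "\<exists>m::int. (\<Sum>z\<in>Z. sgn (f z)) = of_int (int (card Z) + 2 * m)"
  using assms
proof (induction rule: finite_induct)
  case empty
  show ?case by (intro exI[of _ 0]) simp
next
  case (insert z Z)
  then obtain m where m: "(\<Sum>z\<in>Z. sgn (f z)) = of_int (int (card Z) + 2 * m)" by auto
  have "f z \<noteq> 0" using insert.prems by simp
  then consider "0 < f z" | "f z < 0" by linarith
  then show ?case
  proof cases
    case 1
    then show ?thesis using insert.hyps m by (intro exI[of _ m]) simp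
  next
    case 2
    then show ?thesis using insert.hyps m by (intro exI[of _ "m - 1"]) simp
  qed
qed

text \<open>At both ends the degree integral is the same positive constant times the sum of signs,
  so these sums agree; modulo 2 a sum of signs is the number of zeros.\<close>

theorem odd_card_zeros_homotopy:
  fixes H :: "real \<times> (real^'m::{finite,wellorder}) \<Rightarrow> real^'m::_"
  assumes poly: "\<And>i. real_polynomial_function (\<lambda>z. H z $ i)"
    and G: "open G" "bounded G"
    and fr: "\<And>t x. t \<in> {0..1} \<Longrightarrow> x \<in> frontier G \<Longrightarrow> H (t, x) \<noteq> 0"
    and reg: "\<And>t x. t \<in> {0, 1} \<Longrightarrow> x \<in> G \<Longrightarrow> H (t, x) = 0 \<Longrightarrow> det (jacobian (\<lambda>x. H (t, x)) x) \<noteq> 0"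
  shows "odd (card {x \<in> G. H (0, x) = 0}) \<longleftrightarrow> odd (card {x \<in> G. H (1, x) = 0})"
proof -
  define J where "J t x = det (jacobian (\<lambda>x. H (t, x)) x)" for t x
  define \<Sigma> where "\<Sigma> t = (\<Sum>x | x \<in> G \<and> H (t, x) = 0. sgn (J t x))" for t
  obtain a b where ab: "G \<subseteq> cbox a b" using bounded_subset_cbox_symmetric[OF G(2)] by blast
  have cont: "continuous_on S H" for S
    by (subst continuous_on_componentwise)
      (auto simp: Basis_vec_def inner_axis intro: continuous_on_real_polynomial_function poly)
  let ?K = "H ` ({0..1} \<times> frontier G)"
  have "compact ?K"
    by (intro compact_continuous_image cont compact_Times compact_frontier_bounded G(2)) simp
  then have "open (- ?K)" "0 \<in> - ?K" using fr by (auto simp: compact_imp_closed open_Compl)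
  \<comment> \<open>By compactness, \<open>norm (H (t, x))\<close> is at least \<delta> for all
    times and all frontier points.\<close>
  then obtain \<delta> where \<delta>: "0 < \<delta>" "ball 0 \<delta> \<subseteq> - ?K" by (meson openE)
  have polyt: "real_polynomial_function (\<lambda>x. H (t, x) $ i)" for t i
    by (rule real_polynomial_function_Pair[OF poly])
  let ?C = "\<lambda>\<epsilon>::real. integral UNIV (\<lambda>y::real^'m::_. bump (\<epsilon>\<^sup>2 - (norm y)\<^sup>2))"
  let ?u = "\<lambda>\<epsilon> t x. (if x \<in> G then bump (\<epsilon>\<^sup>2 - (norm (H (t, x)))\<^sup>2) else 0) * J t x"
  have ev: "\<forall>\<^sub>F \<epsilon> in at_right 0. (?u \<epsilon> t has_integral ?C \<epsilon> * \<Sigma> t) UNIV" if "t \<in> {0, 1}" for t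
    unfolding \<Sigma>_def J_def
    by (rule eventually_integral_bump_jacobian[OF polyt G]) (use fr reg that in auto)
  have "\<forall>\<^sub>F \<epsilon> in at_right (0::real). 0 < \<epsilon> \<and> \<epsilon> < \<delta>"
    using \<delta>(1) by (auto simp: eventually_at_right_field)
  from eventually_conj[OF this eventually_conj[OF ev[of 0] ev[of 1]]]
  have "\<exists>\<epsilon>. (0 < \<epsilon> \<and> \<epsilon> < \<delta>) \<and>
      (?u \<epsilon> 0 has_integral ?C \<epsilon> * \<Sigma> 0) UNIV \<and> (?u \<epsilon> 1 has_integral ?C \<epsilon> * \<Sigma> 1) UNIV"
    by (intro eventually_happens'[of "at_right (0::real)"]) simp_all
  \<comment> \<open>A single \<epsilon> must serve the counting formula at both ends and stay below
    the bound on the frontier.\<close>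
  then obtain \<epsilon> where \<epsilon>: "0 < \<epsilon>" "\<epsilon> < \<delta>"
    and I: "(?u \<epsilon> 0 has_integral ?C \<epsilon> * \<Sigma> 0) UNIV" "(?u \<epsilon> 1 has_integral ?C \<epsilon> * \<Sigma> 1) UNIV"
    by blast
  have fr\<epsilon>: "\<epsilon> < norm (H (t, x))" if "t \<in> {0..1}" "x \<in> frontier G" for t x
  proof -
    have "H (t, x) \<notin> ball 0 \<delta>" using \<delta>(2) that by blast
    then show ?thesis using \<epsilon>(2) by simp
  qed
  have J: "J t x = det (\<chi> i j. dirderiv (0, axis j 1) (\<lambda>z. H z $ i) (t, x))" for t x
    by (simp add: J_def jacobian_def dirderiv_Pair[OF poly])
  have box: "integral (cbox a b) (?u \<epsilon> t) = integral UNIV (?u \<epsilon> t)" for t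
    by (rule integral_eq_UNIV) (use ab in auto)
  have "integral (cbox a b) (?u \<epsilon> 0) = integral (cbox a b) (?u \<epsilon> 1)"
    using integral_bump_jacobian_homotopy[OF poly G(1) ab \<epsilon>(1) fr\<epsilon>] by (simp add: J)
  then have "?C \<epsilon> * \<Sigma> 0 = ?C \<epsilon> * \<Sigma> 1"
    unfolding box using I by (simp add: integral_unique)
  moreover have "?C \<epsilon> \<noteq> 0" using integral_bump_pos[of \<epsilon>] \<epsilon>(1) by (metis less_irrefl)
  ultimately have eq: "\<Sigma> 0 = \<Sigma> 1" by simp
  have parity: "\<exists>m::int. \<Sigma> t = of_int (int (card {x \<in> G. H (t, x) = 0}) + 2 * m)" if "t \<in> {0, 1}" for t
    unfolding \<Sigma>_def
  proof (rule sum_sgn_parity)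
    show "finite {x \<in> G. H (t, x) = 0}"
      by (rule finite_regular_zeros[OF polyt G]) (use fr reg that in auto)
  qed (use reg that in \<open>auto simp: J_def\<close>)
  obtain m0 :: int where m0: "\<Sigma> 0 = of_int (int (card {x \<in> G. H (0, x) = 0}) + 2 * m0)"
    using parity[of 0] by blast
  obtain m1 :: int where m1: "\<Sigma> 1 = of_int (int (card {x \<in> G. H (1, x) = 0}) + 2 * m1)"
    using parity[of 1] by blast
  have "int (card {x \<in> G. H (0, x) = 0}) + 2 * m0 = int (card {x \<in> G. H (1, x) = 0}) + 2 * m1"
    using eq unfolding m0 m1 by (simp only: of_int_eq_iff)
  then show ?thesis by presburger
qed

section \<open>Positive definite matrices\<close>

lemma symmetric_matrix_inner:
  "symmetric_matrix A \<Longrightarrow> x \<bullet> (A *v y) = (A *v x) \<bullet> y"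
  unfolding symmetric_matrix_def by (metis dot_lmul_matrix vector_transpose_matrix)

lemma quadratic_nonneg_imp_linear_zero:
  fixes a b :: real
  assumes "\<And>t. 0 \<le> a * t\<^sup>2 + b * t"
  shows "b = 0"
proof (rule ccontr)
  assume "b \<noteq> 0"
  \<comment> \<open>\<open>c\<close> is positive and exceeds the absolute value of \<open>a\<close>,
    so at \<open>- (b / c)\<close> the linear term outweighs the quadratic one.\<close>
  define c where "c = \<bar>a\<bar> + 1"
  have "a * (b / c)\<^sup>2 \<le> \<bar>a\<bar> * (b / c)\<^sup>2" by (intro mult_right_mono) auto
  moreover have "\<bar>a\<bar> * (b / c)\<^sup>2 + (b / c)\<^sup>2 = c * (b / c)\<^sup>2" by (simp add: c_def algebra_simps)
  moreover have "c * (b / c)\<^sup>2 = b * (b / c)" by (simp add: c_def power2_eq_square)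
  moreover have "0 < (b / c)\<^sup>2" using \<open>b \<noteq> 0\<close> by (simp add: c_def)
  ultimately have "a * (b / c)\<^sup>2 < b * (b / c)" by linarith
  then show False using assms[of "- (b / c)"] by simp
qed

text \<open>The form is minimal at \<open>v\<close>, so its first variation in the direction
  \<open>A *v v\<close> vanishes; that variation is twice the squared norm of
  \<open>A *v v\<close>.\<close>

lemma semidefinite_kernel:
  fixes A :: "real^'n^'n"
  assumes A: "symmetric_matrix A" "\<And>x. 0 \<le> x \<bullet> (A *v x)" and v: "v \<bullet> (A *v v) = 0"
  shows "A *v v = 0"
proof -
  let ?w = "A *v v"
  have "0 \<le> (?w \<bullet> (A *v ?w)) * t\<^sup>2 + (2 * (?w \<bullet> ?w)) * t" for t
  proof -
    have "(v + t *\<^sub>R ?w) \<bullet> (A *v (v + t *\<^sub>R ?w)) = (?w \<bullet> (A *v ?w)) * t\<^sup>2 + (2 * (?w \<bullet> ?w)) * t"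
      using v symmetric_matrix_inner[OF A(1), of v ?w]
      by (simp add: matrix_vector_right_distrib matrix_vector_mult_scaleR inner_add_left inner_add_right
          power2_eq_square algebra_simps)
    then show ?thesis using A(2)[of "v + t *\<^sub>R ?w"] by simp
  qed
  then have "2 * (?w \<bullet> ?w) = 0" by (rule quadratic_nonneg_imp_linear_zero)
  then show ?thesis by simp
qed

text \<open>Rayleigh's principle: let \<open>e\<close> be the minimum of the form on the unit
  sphere. Then \<open>A\<close> minus \<open>e\<close> times the identity is positive semidefinite,
  and its form vanishes at the minimizer, which is therefore an eigenvector.\<close>

lemma exists_least_eigenvalue:
  fixes A :: "real^'n^'n"
  assumes A: "symmetric_matrix A"
  obtains e where "eigenvalue A e" "\<And>x. e * (x \<bullet> x) \<le> x \<bullet> (A *v x)"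
proof -
  have ne: "sphere (0::real^'n) 1 \<noteq> {}" by simp
  have "continuous_on (sphere 0 1) (\<lambda>x. x \<bullet> (A *v x))"
    by (intro continuous_intros linear_continuous_on matrix_vector_mul_bounded_linear)
  from continuous_attains_inf[OF compact_sphere ne this] obtain v where v: "v \<in> sphere 0 1"
    and min: "\<And>x. x \<in> sphere 0 1 \<Longrightarrow> v \<bullet> (A *v v) \<le> x \<bullet> (A *v x)"
    by blast
  let ?e = "v \<bullet> (A *v v)"
  have le: "?e * (x \<bullet> x) \<le> x \<bullet> (A *v x)" for x
  proof (cases "x = 0")
    case False
    have "?e \<le> (x /\<^sub>R norm x) \<bullet> (A *v (x /\<^sub>R norm x))"
      using min[of "x /\<^sub>R norm x"] False by simp
    also have "\<dots> = (x \<bullet> (A *v x)) / (x \<bullet> x)"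
      using False by (simp add: matrix_vector_mult_scaleR power2_norm_eq_inner[symmetric] power2_eq_square divide_simps)
    finally show ?thesis using False by (simp add: pos_le_divide_eq)
  qed simp
  have vv: "v \<bullet> v = 1" using v by (simp add: norm_eq_1)
  let ?B = "A - ?e *\<^sub>R mat 1"
  have B: "?B *v x = A *v x - ?e *\<^sub>R x" for x
    by (simp add: matrix_vector_mult_diff_rdistrib scaleR_matrix_vector_assoc[symmetric])
  have "?B *v v = 0"
  proof (rule semidefinite_kernel)
    show "symmetric_matrix ?B"
      using A by (simp add: symmetric_matrix_def transpose_def vec_eq_iff mat_def)
    show "0 \<le> x \<bullet> (?B *v x)" for x using le[of x] by (simp add: B inner_diff_right)
    show "v \<bullet> (?B *v v) = 0" using vv by (simp add: B inner_diff_right)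
  qed
  then have "A *v v = ?e *s v" by (simp add: B scalar_mult_eq_scaleR)
  moreover have "v \<noteq> 0" using vv by auto
  ultimately have "eigenvalue A ?e" unfolding eigenvalue_def by blast
  then show ?thesis using le that by blast
qed

lemma positive_definite_iff:
  fixes A :: "real^'n^'n"
  shows "positive_definite A \<longleftrightarrow> symmetric_matrix A \<and> (\<forall>x. x \<noteq> 0 \<longrightarrow> 0 < x \<bullet> (A *v x))"
proof (intro iffI conjI allI impI)
  assume A: "positive_definite A"
  then show sym: "symmetric_matrix A" by (simp add: positive_definite_def)
  fix x :: "real^'n" assume "x \<noteq> 0"
  obtain e where e: "eigenvalue A e" "e * (x \<bullet> x) \<le> x \<bullet> (A *v x)"
    using exists_least_eigenvalue[OF sym] by blast
  then have "0 < e * (x \<bullet> x)" using A \<open>x \<noteq> 0\<close> by (simp add: positive_definite_def)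
  then show "0 < x \<bullet> (A *v x)" using e(2) by linarith
next
  assume A: "symmetric_matrix A \<and> (\<forall>x. x \<noteq> 0 \<longrightarrow> 0 < x \<bullet> (A *v x))"
  have "0 < e" if "eigenvalue A e" for e
  proof -
    from that obtain v where v: "v \<noteq> 0" "A *v v = e *s v" by (auto simp: eigenvalue_def)
    then have "0 < e * (v \<bullet> v)" using A by (metis inner_scaleR_right scalar_mult_eq_scaleR)
    then show ?thesis by (rule zero_less_mult_pos2) (use v(1) in simp)
  qed
  then show "positive_definite A" using A by (simp add: positive_definite_def)
qed

lemma positive_definite_mat_1: "positive_definite (mat 1 :: real^'n^'n)"
  by (simp add: positive_definite_iff symmetric_matrix_def)

lemma det_eq_0_iff_kernel:
  fixes A :: "real^'n^'n"
  shows "det A = 0 \<longleftrightarrow> (\<exists>x. x \<noteq> 0 \<and> A *v x = 0)"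
  using invertible_det_nz[of A] invertible_left_inverse[of A] matrix_left_invertible_ker[of A] by auto

lemma positive_definite_det_nonzero:
  "positive_definite A \<Longrightarrow> det A \<noteq> 0"
  by (force simp: det_eq_0_iff_kernel positive_definite_iff)

lemma semidefinite_det_nonzero_imp_positive_definite:
  fixes A :: "real^'n^'n"
  assumes "symmetric_matrix A" "\<And>x. 0 \<le> x \<bullet> (A *v x)" "det A \<noteq> 0"
  shows "positive_definite A"
proof -
  have "x \<bullet> (A *v x) \<noteq> 0" if "x \<noteq> 0" for x
    using semidefinite_kernel[OF assms(1,2), of x] that assms(3)
    by (auto simp: det_eq_0_iff_kernel)
  then show ?thesis using assms(1,2) by (simp add: positive_definite_iff order_less_le)
qed

lemma positive_definite_convex:
  assumes A: "positive_definite A" and B: "positive_definite B" and t: "t \<in> {0..1}"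
  shows "positive_definite ((1 - t) *\<^sub>R A + t *\<^sub>R B)"
  unfolding positive_definite_iff
proof (intro conjI allI impI)
  show "symmetric_matrix ((1 - t) *\<^sub>R A + t *\<^sub>R B)"
    using A B by (simp add: positive_definite_iff symmetric_matrix_def transpose_def vec_eq_iff)
  fix x :: "real^'a" assume "x \<noteq> 0"
  then have a: "0 < x \<bullet> (A *v x)" and b: "0 < x \<bullet> (B *v x)" using A B by (simp_all add: positive_definite_iff)
  have "0 < (1 - t) * (x \<bullet> (A *v x)) + t * (x \<bullet> (B *v x))"
  proof (cases "t = 0")
    case False
    then have "0 < t * (x \<bullet> (B *v x))" using t b by simp
    moreover have "0 \<le> (1 - t) * (x \<bullet> (A *v x))" using t a by simp
    ultimately show ?thesis by linarith
  qed (use a in simp)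
  then show "0 < x \<bullet> (((1 - t) *\<^sub>R A + t *\<^sub>R B) *v x)"
    by (simp add: matrix_vector_mult_add_rdistrib scaleR_matrix_vector_assoc[symmetric] inner_add_right)
qed

text \<open>By scaling, unit vectors are enough to test; the complement is then the projection of a
  closed set along the compact unit sphere, hence closed.\<close>

lemma open_quadratic_form_pos:
  "open {A :: real^'n^'n. \<forall>x. x \<noteq> 0 \<longrightarrow> 0 < x \<bullet> (A *v x)}"
proof -
  let ?T = "{p :: (real^'n) \<times> (real^'n^'n). fst p \<bullet> (snd p *v fst p) \<le> 0}"
  have "continuous_on UNIV (\<lambda>p :: (real^'n) \<times> (real^'n^'n). fst p \<bullet> (snd p *v fst p))"
    unfolding matrix_vector_mult_def inner_vec_def by (intro continuous_intros)
  then have "closed ?T" by (intro closed_Collect_le continuous_on_const)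
  then have closed: "closed {A. \<exists>x. x \<in> sphere 0 1 \<and> (x, A) \<in> ?T}"
    by (intro closed_compact_projection compact_sphere)
  have "- {A. \<exists>x. x \<in> sphere 0 1 \<and> (x, A) \<in> ?T} = {A. \<forall>x. x \<noteq> 0 \<longrightarrow> 0 < x \<bullet> (A *v x)}"
  proof (intro set_eqI iffI)
    fix A :: "real^'n^'n" assume "A \<in> - {A. \<exists>x. x \<in> sphere 0 1 \<and> (x, A) \<in> ?T}"
    then have *: "0 < x \<bullet> (A *v x)" if "norm x = 1" for x using that by force
    have "0 < x \<bullet> (A *v x)" if "x \<noteq> 0" for x
    proof -
      have "0 < (x /\<^sub>R norm x) \<bullet> (A *v (x /\<^sub>R norm x))" using *[of "x /\<^sub>R norm x"] that by simp
      then show ?thesis using that by (simp add: matrix_vector_mult_scaleR zero_less_mult_iff)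
    qed
    then show "A \<in> {A. \<forall>x. x \<noteq> 0 \<longrightarrow> 0 < x \<bullet> (A *v x)}" by simp
  next
    fix A :: "real^'n^'n" assume "A \<in> {A. \<forall>x. x \<noteq> 0 \<longrightarrow> 0 < x \<bullet> (A *v x)}"
    then have pos: "\<And>x. x \<noteq> 0 \<Longrightarrow> 0 < x \<bullet> (A *v x)" by blast
    have "(x, A) \<notin> ?T" if "x \<in> sphere 0 1" for x
    proof -
      have "x \<noteq> 0" using that by auto
      then show ?thesis using pos[of x] by simp
    qed
    then show "A \<in> - {A. \<exists>x. x \<in> sphere 0 1 \<and> (x, A) \<in> ?T}" by blast
  qed
  with open_Compl[OF closed] show ?thesis by (simp only:)
qed

section \<open>Word matrices\<close>

lemma word_matrix_Nil [simp]: "word_matrix [] X B = mat 1"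
  and word_matrix_Cons [simp]: "word_matrix (l # w) X B = letter_matrix X B l ** word_matrix w X B"
  by (simp_all add: word_matrix_def)

lemma word_matrix_append: "word_matrix (u @ w) X B = word_matrix u X B ** word_matrix w X B"
  by (induction u) (simp_all add: matrix_mul_assoc)

lemma word_matrix_replicate:
  "word_matrix (replicate q l) X B *v v = (((*v) (letter_matrix X B l)) ^^ q) v"
  by (induction q) (simp_all add: matrix_vector_mul_assoc[symmetric])

lemma transpose_word_matrix:
  assumes "symmetric_matrix X" "\<And>i. LB i \<in> set w \<Longrightarrow> symmetric_matrix (B i)"
  shows "transpose (word_matrix w X B) = word_matrix (rev w) X B"
  using assms(2)
proof (induction w)
  case (Cons l w)
  have "transpose (letter_matrix X B l) = letter_matrix X B l"
    using assms(1) Cons.prems by (cases l) (auto simp: symmetric_matrix_def)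
  then show ?case using Cons by (simp add: word_matrix_append matrix_transpose_mul)
qed (simp add: transpose_mat)

lemma symmetric_word_matrix:
  assumes "symmetric_word w" "symmetric_matrix X" "\<And>i. LB i \<in> set w \<Longrightarrow> symmetric_matrix (B i)"
  shows "symmetric_matrix (word_matrix w X B)"
  using transpose_word_matrix[of X w B] assms by (simp add: symmetric_matrix_def symmetric_word_def)

lemma word_matrix_scaleR:
  "word_matrix w (r *\<^sub>R X) B = r ^ count_list w LX *\<^sub>R word_matrix w X B"
proof (induction w)
  case (Cons l w)
  then show ?case
    by (cases l) (auto simp: matrix_scalar_ac scalar_matrix_assoc[symmetric] mult.commute)
qed simp

text \<open>The determinant is multiplicative, and \<open>X\<close> is one of the factors.\<close>

lemma det_word_matrix_nonzero:
  assumes "LX \<in> set w" "det (word_matrix w X B) \<noteq> 0"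
  shows "det X \<noteq> 0"
  using assms by (induction w) (auto simp: det_mul)

lemma real_polynomial_function_word_matrix:
  assumes "\<And>i j. real_polynomial_function (\<lambda>z. X z $ i $ j)"
    and "\<And>l i j. real_polynomial_function (\<lambda>z. B z l $ i $ j)"
  shows "real_polynomial_function (\<lambda>z. word_matrix w (X z) (B z) $ i $ j)"
proof (induction w arbitrary: i j)
  case Nil
  show ?case by (simp add: real_polynomial_function.intros(2))
next
  case (Cons l w)
  have "real_polynomial_function (\<lambda>z. letter_matrix (X z) (B z) l $ i $ j)" for i j
    using assms by (cases l) auto
  then show ?case
    unfolding word_matrix_Cons matrix_matrix_mult_def
    by (simp, intro real_polynomial_function_sum real_polynomial_function.intros(4) Cons.IH) auto
qed

lemma bounded_bilinear_matrix_matrix_mult: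
  "bounded_bilinear ((**) :: real^'n^'n \<Rightarrow> real^'n^'n \<Rightarrow> real^'n^'n)"
  unfolding bilinear_conv_bounded_bilinear[symmetric] bilinear_def
  by (intro conjI allI linearI)
    (simp_all add: vec_eq_iff matrix_matrix_mult_def algebra_simps sum.distrib sum_distrib_left)

section \<open>The starting equation, in which every constant letter is the identity\<close>

lemma word_matrix_mat_1: "word_matrix w (mat 1) (\<lambda>_. mat 1) = mat 1"
proof (induction w)
  case (Cons l w)
  then show ?case by (cases l) auto
qed simp

text \<open>All factors are the identity at this point, so the product rule contributes one copy of
  \<open>V\<close> for each occurrence of \<open>LX\<close>.\<close>

lemma has_derivative_word_matrix_mat_1:
  "((\<lambda>X. word_matrix w X (\<lambda>_. mat 1)) has_derivative (\<lambda>V. real (count_list w LX) *\<^sub>R V))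
    (at (mat 1 :: real^'n^'n))"
proof (induction w)
  case Nil
  show ?case by simp
next
  case (Cons l w)
  show ?case
  proof (cases l)
    case LX
    have "((\<lambda>X. X ** word_matrix w X (\<lambda>_. mat 1)) has_derivative
        (\<lambda>V. mat 1 ** (real (count_list w LX) *\<^sub>R V) + V ** word_matrix w (mat 1) (\<lambda>_. mat 1)))
        (at (mat 1 :: real^'n^'n))"
      by (rule bounded_bilinear.FDERIV[OF bounded_bilinear_matrix_matrix_mult has_derivative_ident Cons.IH])
    then show ?thesis using LX by (simp add: word_matrix_mat_1 algebra_simps)
  next
    case LB
    then show ?thesis using Cons.IH by simp
  qed
qed

lemma word_matrix_mat_1_letters:
  "word_matrix w X (\<lambda>_. mat 1) *v v = (((*v) X) ^^ count_list w LX) v"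
proof (induction w arbitrary: v)
  case (Cons l w)
  then show ?case by (cases l) (auto simp: matrix_vector_mul_assoc[symmetric])
qed simp

text \<open>Induction in steps of two: symmetry moves one factor \<open>A\<close> to the left, so
  the form of a power at \<open>x\<close> becomes the form of the power lower by two at the nonzero
  vector \<open>A *v x\<close>.\<close>

lemma quadratic_form_power_pos:
  fixes A :: "real^'n^'n"
  assumes A: "positive_definite A" and "x \<noteq> 0"
  shows "0 < x \<bullet> ((((*v) A) ^^ q) x)"
  using \<open>x \<noteq> 0\<close>
proof (induction q arbitrary: x rule: induct_nat_012)
  case 0
  then show ?case by simp
next
  case 1
  then show ?case using A by (simp add: positive_definite_iff)
next
  case (ge2 q)
  have sym: "symmetric_matrix A" and "0 < x \<bullet> (A *v x)"
    using A ge2.prems by (simp_all add: positive_definite_iff)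
  then have "A *v x \<noteq> 0" by auto
  then have "0 < (A *v x) \<bullet> ((((*v) A) ^^ q) (A *v x))" by (rule ge2.IH(1))
  moreover have "(((*v) A) ^^ Suc (Suc q)) x = A *v ((((*v) A) ^^ q) (A *v x))"
    by (simp add: funpow_swap1)
  ultimately show ?case by (simp only: symmetric_matrix_inner[OF sym])
qed

text \<open>For \<open>u = X *v v - v\<close> the powers of \<open>X\<close> below \<open>d\<close>,
  applied to \<open>u\<close>, telescope to zero. Pairing the sum with a nonzero \<open>u\<close>
  would give a sum of positive terms.\<close>

lemma power_eq_identity_imp_eq_mat_1:
  fixes X :: "real^'n^'n"
  assumes X: "positive_definite X" and d: "0 < d" and eq: "\<And>v. (((*v) X) ^^ d) v = v"
  shows "X = mat 1"
proof -
  have "X *v v - v = 0" for v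
  proof (rule ccontr)
    let ?u = "X *v v - v"
    assume u: "?u \<noteq> 0"
    have diff: "(((*v) X) ^^ j) (x - y) = (((*v) X) ^^ j) x - (((*v) X) ^^ j) y" for j x y
      by (induction j) (simp_all add: matrix_vector_mult_diff_distrib)
    have "(\<Sum>j<d. (((*v) X) ^^ j) ?u) = (\<Sum>j<d. (((*v) X) ^^ Suc j) v - (((*v) X) ^^ j) v)"
      by (simp add: diff funpow_swap1)
    also have "\<dots> = (((*v) X) ^^ d) v - v"
      by (subst sum_lessThan_telescope) simp
    also have "\<dots> = 0" by (simp add: eq)
    finally have "(\<Sum>j<d. ?u \<bullet> ((((*v) X) ^^ j) ?u)) = 0" by (simp flip: inner_sum_right)
    moreover have "0 < (\<Sum>j<d. ?u \<bullet> ((((*v) X) ^^ j) ?u))"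
      by (rule sum_pos) (use d quadratic_form_power_pos[OF X u] in auto)
    ultimately show False by simp
  qed
  then show ?thesis by (simp add: matrix_eq)
qed

text \<open>Interlacing guarantees that between two powers of \<open>X\<close> only matrices with positive quadratic
  form occur, so the range of a symmetric matrix stays away from the kernel throughout the word.\<close>

lemma range_symmetric_compression:
  fixes Y :: "real^'n^'n"
  assumes Y: "symmetric_matrix Y" and v: "v \<in> range ((*v) Y) - {0}" and c: "0 < v \<bullet> c"
  shows "Y *v c \<in> range ((*v) Y) - {0}"
proof -
  obtain u where "v = Y *v u" using v by blast
  then have "Y *v c \<noteq> 0" using c symmetric_matrix_inner[OF Y, of u c] by auto
  then show ?thesis by blast
qed

lemma range_symmetric_power:
  assumes Y: "symmetric_matrix Y" and v: "v \<in> range ((*v) Y) - {0}"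
  shows "(((*v) Y) ^^ p) v \<in> range ((*v) Y) - {0}"
proof (induction p)
  case (Suc p)
  then show ?case using range_symmetric_compression[OF Y Suc] by simp
qed (use v in simp)

text \<open>The word acts from the right on a vector that stays nonzero in the range of
  \<open>Y\<close> after every block; the leading power of a letter cannot kill it, having positive
  quadratic form.\<close>

lemma interlaced_word_matrix_nonzero:
  fixes Y :: "real^'n^'n"
  assumes w: "interlaced k w" and Y: "symmetric_matrix Y" "Y \<noteq> 0"
    and B: "\<And>i. i \<in> {1..k} \<Longrightarrow> positive_definite (B i)"
  shows "word_matrix w Y B \<noteq> 0"
proof -
  obtain m i p q where mipq: "\<forall>j\<in>{1..m}. 0 < p j" "\<forall>j\<in>{1..m + 1}. i j \<in> {1..k}" "w = interlaced_form m i p q"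
    using w unfolding interlaced_def by blast
  let ?R = "range ((*v) Y) - {0}"
  let ?block = "\<lambda>j. replicate (p j) LX @ replicate (q (j + 1)) (LB (i (j + 1)))"
  obtain u where "Y *v u \<noteq> 0" using Y(2) by (auto simp: matrix_eq)
  then have u: "Y *v u \<in> ?R" by blast
  have "\<exists>v. word_matrix (concat (map ?block js)) Y B *v v \<in> ?R" if "set js \<subseteq> {1..m}" for js
    using that
  proof (induction js)
    case Nil
    show ?case by (rule exI[of _ "Y *v u"]) (use u in simp)
  next
    case (Cons j js)
    then obtain v where v: "word_matrix (concat (map ?block js)) Y B *v v \<in> ?R" by auto
    let ?v = "word_matrix (concat (map ?block js)) Y B *v v"
    have Bj: "positive_definite (B (i (j + 1)))" and pj: "0 < p j" using B mipq Cons.prems by auto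
    have "0 < ?v \<bullet> ((((*v) (B (i (j + 1)))) ^^ q (j + 1)) ?v)"
      by (rule quadratic_form_power_pos[OF Bj]) (use v in blast)
    \<comment> \<open>The first of the \<open>p j\<close> factors \<open>Y\<close> brings the vector
      back into the range, nonzero; the other \<open>p j - 1\<close> keep it there.\<close>
    from range_symmetric_power[OF Y(1) range_symmetric_compression[OF Y(1) v this], of "p j - 1"]
    have "(((*v) Y) ^^ p j) ((((*v) (B (i (j + 1)))) ^^ q (j + 1)) ?v) \<in> ?R"
      using pj by (cases "p j") (simp_all add: funpow_swap1)
    then have "word_matrix (concat (map ?block (j # js))) Y B *v v \<in> ?R"
      by (simp add: word_matrix_append word_matrix_replicate matrix_vector_mul_assoc[symmetric])
    then show ?case ..
  qed
  from this[of "[1..<m + 1]"] obtain v where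
    v: "word_matrix (concat (map ?block [1..<m + 1])) Y B *v v \<in> ?R" by force
  let ?v = "word_matrix (concat (map ?block [1..<m + 1])) Y B *v v"
  have B1: "positive_definite (B (i 1))" using B mipq(2) by simp
  have "0 < ?v \<bullet> ((((*v) (B (i 1))) ^^ q 1) ?v)"
    by (rule quadratic_form_power_pos[OF B1]) (use v in blast)
  moreover have "word_matrix w Y B *v v = (((*v) (B (i 1))) ^^ q 1) ?v"
    by (simp only: mipq(3) interlaced_form_def word_matrix_append matrix_vector_mul_assoc[symmetric]
        word_matrix_replicate letter_matrix.simps)
  ultimately show ?thesis by auto
qed

lemma interlaced_letters:
  assumes "interlaced k w"
  shows "LX \<in> set w" "\<And>i. LB i \<in> set w \<Longrightarrow> i \<in> {1..k}"
proof -
  obtain m i p q where m: "1 \<le> m" "\<forall>j\<in>{1..m}. 0 < p j" "\<forall>j\<in>{1..m + 1}. i j \<in> {1..k}"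
    "w = interlaced_form m i p q"
    using assms unfolding interlaced_def by blast
  have "1 \<in> {1..m}" using m(1) by simp
  then have "0 < p 1" using m(2) by blast
  then show "LX \<in> set w"
    using \<open>1 \<in> {1..m}\<close> unfolding m(4) interlaced_form_def by (auto simp del: upt_Suc intro!: bexI[of _ 1])
  show "l \<in> {1..k}" if "LB l \<in> set w" for l
  proof -
    from that have "l = i 1 \<or> (\<exists>j\<in>{1..<m + 1}. l = i (j + 1))"
      unfolding m(4) interlaced_form_def by (auto simp del: upt_Suc split: if_splits)
    then show ?thesis using m(3) by auto
  qed
qed

section \<open>Coordinates on the space of symmetric matrices\<close>

text \<open>As a type, the lower triangular positions can index vectors. Symmetric matrices thus
  become points of a Cartesian space, to which Jacobians, the degree argument and Sard's theorem
  apply.\<close>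

typedef (overloaded) 'n lower = "lower_index :: ('n::{finite,wellorder} \<times> 'n) set"
  by (auto simp: lower_index_def)

instance lower :: ("{finite,wellorder}") finite
proof
  have "finite (Abs_lower ` (lower_index :: ('a \<times> 'a) set))" by simp
  then show "finite (UNIV :: 'a lower set)"
    by (simp add: type_definition.Abs_image[OF type_definition_lower])
qed

text \<open>The degree theorem requires a well-ordered index type; the lexicographic order serves as
  one.\<close>

instantiation lower :: ("{finite,wellorder}") wellorder
begin

definition "a \<le> b \<longleftrightarrow> fst (Rep_lower a) < fst (Rep_lower b) \<or>
  fst (Rep_lower a) = fst (Rep_lower b) \<and> snd (Rep_lower a) \<le> snd (Rep_lower b)"

definition "a < b \<longleftrightarrow> a \<le> b \<and> \<not> b \<le> (a :: 'a lower)"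

instance
proof
  fix a b c :: "'a lower"
  show "a < b \<longleftrightarrow> a \<le> b \<and> \<not> b \<le> a" by (rule less_lower_def)
  show "a \<le> a" "a \<le> b \<or> b \<le> a" by (auto simp: less_eq_lower_def)
  show "a \<le> b \<Longrightarrow> b \<le> c \<Longrightarrow> a \<le> c" by (auto simp: less_eq_lower_def)
  show "a \<le> b \<Longrightarrow> b \<le> a \<Longrightarrow> a = b"
    by (auto simp: less_eq_lower_def Rep_lower_inject[symmetric] prod_eq_iff)
next
  fix P :: "'a lower \<Rightarrow> bool" and a
  assume step: "\<And>x. (\<And>y. y < x \<Longrightarrow> P y) \<Longrightarrow> P x"
  have trans: "x \<le> y \<Longrightarrow> y \<le> z \<Longrightarrow> x \<le> z" for x y z :: "'a lower"
    by (auto simp: less_eq_lower_def)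
  show "P a"
  \<comment> \<open>Well-foundedness comes from finiteness: the number of predecessors strictly
    drops.\<close>
  proof (induction a rule: measure_induct_rule[of "\<lambda>x :: 'a lower. card {y. y < x}"])
    case (less x)
    show ?case
    proof (rule step)
      fix y assume y: "y < x"
      have "{z. z < y} \<subseteq> {z. z < x}" using y trans unfolding less_lower_def by blast
      moreover have "y \<in> {z. z < x}" "y \<notin> {z. z < y}" using y by (auto simp: less_lower_def)
      ultimately have "{z. z < y} \<subset> {z. z < x}" by blast
      then have "card {z. z < y} < card {z. z < x}" by (rule psubset_card_mono[OF finite])
      then show "P y" by (rule less.IH)
    qed
  qed
qed

end

definition sym_of :: "real^('n::{finite,wellorder} lower) \<Rightarrow> real^'n::_^'n::_" where
  "sym_of x = symmetric_of_lower (\<lambda>p. x $ Abs_lower p)"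

definition low_of :: "real^'n::{finite,wellorder}^'n::_ \<Rightarrow> real^('n::_ lower)" where
  "low_of A = (\<chi> l. A $ fst (Rep_lower l) $ snd (Rep_lower l))"

lemma symmetric_sym_of: "symmetric_matrix (sym_of x)"
  unfolding sym_of_def by (rule symmetric_of_lower_symmetric)

lemma low_of_sym_of [simp]: "low_of (sym_of x) = x"
proof -
  have "sym_of x $ fst (Rep_lower l) $ snd (Rep_lower l) = x $ l" for l
    using Rep_lower[of l]
    by (auto simp: sym_of_def symmetric_of_lower_def lower_index_def Rep_lower_inverse split: prod.splits)
  then show ?thesis by (simp add: low_of_def vec_eq_iff)
qed

lemma sym_of_low_of: "symmetric_matrix A \<Longrightarrow> sym_of (low_of A) = A"
proof -
  assume "symmetric_matrix A"
  then have "A $ i $ j = A $ j $ i" for i j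
    unfolding symmetric_matrix_def transpose_def by (metis vec_lambda_beta)
  then show ?thesis
    by (auto simp: vec_eq_iff sym_of_def low_of_def symmetric_of_lower_def lower_index_def Abs_lower_inverse)
qed

lemma sym_of_inject: "sym_of x = sym_of y \<longleftrightarrow> x = y"
  by (metis low_of_sym_of)

lemma low_of_eq_iff: "symmetric_matrix A \<Longrightarrow> symmetric_matrix B \<Longrightarrow> low_of A = low_of B \<longleftrightarrow> A = B"
  by (metis sym_of_low_of)

lemma bounded_linear_sym_of: "bounded_linear sym_of"
  by (intro linear_conv_bounded_linear[THEN iffD1] linearI)
    (simp_all add: vec_eq_iff sym_of_def symmetric_of_lower_def)

lemma bounded_linear_low_of: "bounded_linear low_of"
  by (intro linear_conv_bounded_linear[THEN iffD1] linearI) (simp_all add: vec_eq_iff low_of_def)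

lemma sym_of_vec_lambda:
  "sym_of (\<chi> l. v (Rep_lower l)) = symmetric_of_lower v"
  by (auto simp: sym_of_def symmetric_of_lower_def vec_eq_iff Abs_lower_inverse lower_index_def)

section \<open>Lebesgue measure in lower triangular coordinates\<close>

lemma measurable_vec_lambda_lower:
  "(\<lambda>v. (\<chi> l. v (Rep_lower l)) :: real^('n::{finite,wellorder} lower))
    \<in> borel_measurable (\<Pi>\<^sub>M ij\<in>lower_index. (lborel :: real measure))"
    (is "?f \<in> borel_measurable ?M")
proof (subst borel_measurable_euclidean_space, intro ballI)
  fix b :: "real^('n lower)" assume "b \<in> Basis"
  then obtain l where "b = axis l 1" by (auto simp: Basis_vec_def)
  moreover have "(\<lambda>v. v (Rep_lower l)) \<in> borel_measurable ?M"
    using measurable_component_singleton[OF Rep_lower[of l], of "\<lambda>_. lborel :: real measure"] by simp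
  ultimately show "(\<lambda>v. ?f v \<bullet> b) \<in> borel_measurable ?M" by (simp add: inner_axis)
qed

text \<open>Lebesgue measure is determined by the volumes of boxes, and a box pulls back under the
  reindexing to a product of intervals.\<close>

lemma lborel_lower_eq_distr:
  "(lborel :: (real^('n::{finite,wellorder} lower)) measure) =
    distr (\<Pi>\<^sub>M ij\<in>lower_index. (lborel :: real measure)) borel (\<lambda>v. \<chi> l. v (Rep_lower l))"
    (is "_ = distr ?M borel ?f")
proof (rule lborel_eqI)
  interpret product_sigma_finite "\<lambda>_ :: 'n \<times> 'n. lborel :: real measure" ..
  have f: "?f \<in> borel_measurable ?M" by (rule measurable_vec_lambda_lower)
  fix l u :: "real^('n lower)"
  assume le: "\<And>b. b \<in> Basis \<Longrightarrow> l \<bullet> b \<le> u \<bullet> b"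
  have le': "l $ i \<le> u $ i" for i
    using le[of "axis i 1"] by (simp add: inner_axis axis_in_Basis_iff)
  let ?B = "\<lambda>p. {l $ Abs_lower p <..< u $ Abs_lower p}"
  have "?f -` box l u \<inter> space ?M = (\<Pi>\<^sub>E p\<in>lower_index. ?B p)"
  proof -
    have "(\<forall>i. v (Rep_lower i) \<in> ?B (Rep_lower i)) \<longleftrightarrow> (\<forall>p\<in>lower_index. v p \<in> ?B p)" for v :: "'n \<times> 'n \<Rightarrow> real"
      using Rep_lower Abs_lower_inverse by metis
    then show ?thesis
      by (auto simp: mem_box_cart space_PiM PiE_def Pi_def Rep_lower_inverse)
  qed
  then have "emeasure (distr ?M borel ?f) (box l u) = emeasure ?M (\<Pi>\<^sub>E p\<in>lower_index. ?B p)"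
    using f by (simp add: emeasure_distr)
  also have "\<dots> = (\<Prod>p\<in>lower_index. emeasure lborel (?B p))"
    by (rule emeasure_PiM) auto
  also have "\<dots> = (\<Prod>p\<in>lower_index. ennreal (u $ Abs_lower p - l $ Abs_lower p))"
    using le' by simp
  also have "\<dots> = (\<Prod>i\<in>UNIV. ennreal (u $ i - l $ i))"
    by (rule prod.reindex_bij_witness[of _ Rep_lower Abs_lower])
      (auto simp: Rep_lower Abs_lower_inverse Rep_lower_inverse)
  also have "\<dots> = ennreal (\<Prod>i\<in>UNIV. u $ i - l $ i)"
    using le' by (simp add: prod_ennreal)
  also have "(\<Prod>i\<in>UNIV. u $ i - l $ i) = (\<Prod>b\<in>Basis. (u - l) \<bullet> b)"
  proof -
    have B: "(Basis :: (real^('n lower)) set) = range (\<lambda>i. axis i 1)" by (auto simp: Basis_vec_def)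
    have "inj (\<lambda>i. axis i 1 :: real^('n lower))" by (simp add: inj_on_def axis_eq_axis)
    then show ?thesis unfolding B by (subst prod.reindex) (simp_all add: inner_axis)
  qed
  finally show "emeasure (distr ?M borel ?f) (box l u) = ennreal (\<Prod>b\<in>Basis. (u - l) \<bullet> b)" .
qed simp

text \<open>Transfers null sets of coordinate vectors to the measure on symmetric matrices, by way
  of the product measure.\<close>

lemma AE_lebesgue_symmetric_if_negligible:
  fixes N :: "(real^('n::{finite,wellorder} lower)) set"
  assumes "negligible N" and Q: "\<And>x. x \<notin> N \<Longrightarrow> Q (sym_of x)"
  shows "AE P in lebesgue_symmetric. Q P"
proof -
  let ?M = "\<Pi>\<^sub>M ij\<in>(lower_index :: ('n \<times> 'n) set). (lborel :: real measure)"
  let ?f = "\<lambda>v :: 'n \<times> 'n \<Rightarrow> real. (\<chi> l. v (Rep_lower l)) :: real^('n lower)"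
  have "AE x in lebesgue. x \<notin> N"
    using assms(1) by (intro AE_not_in) (simp add: negligible_iff_null_sets)
  then have "AE x in lborel. x \<notin> N" by (simp add: AE_completion_iff)
  then have "AE x in distr ?M borel ?f. x \<notin> N" by (subst (asm) lborel_lower_eq_distr)
  moreover have "?f \<in> borel_measurable ?M"
    by (rule measurable_vec_lambda_lower)
  ultimately have "AE v in ?M. ?f v \<notin> N" by (rule AE_distrD[rotated])
  then have "AE v in ?M. Q (symmetric_of_lower v)"
  proof (rule eventually_mono)
    fix v assume "?f v \<notin> N"
    then have "Q (sym_of (?f v))" by (rule Q)
    then show "Q (symmetric_of_lower v)" by (simp add: sym_of_vec_lambda)
  qed
  then show ?thesis by (simp add: AE_lebesgue_symmetric_iff)
qed

section \<open>Solutions of the word equation\<close>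

lemma continuous_on_word_matrix:
  fixes X :: "'a::topological_space \<Rightarrow> real^'n^'n"
  assumes "continuous_on T X" "\<And>i. continuous_on T (\<lambda>z. B z i)"
  shows "continuous_on T (\<lambda>z. word_matrix w (X z) (B z))"
proof (induction w)
  case (Cons l w)
  have "continuous_on T (\<lambda>z. letter_matrix (X z) (B z) l)" using assms by (cases l) auto
  then show ?case
    by (simp add: bounded_bilinear.continuous_on[OF bounded_bilinear_matrix_matrix_mult _ Cons.IH])
qed (simp add: continuous_on_const)

lemma closed_symmetric_matrices: "closed {A :: real^'n^'n. symmetric_matrix A}"
proof -
  have "{A :: real^'n^'n. symmetric_matrix A} = (\<Inter>i. \<Inter>j. {A. A $ i $ j = A $ j $ i})"
    by (auto simp: symmetric_matrix_def transpose_def vec_eq_iff)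
  then show ?thesis
    by (simp only:) (intro closed_INT ballI closed_Collect_eq continuous_intros)
qed

text \<open>By homogeneity in \<open>X\<close> it suffices to bound the word from below on the unit sphere.\<close>

lemma word_matrix_norm_lower_bound:
  fixes B :: "nat \<Rightarrow> real^'n^'n"
  assumes w: "interlaced k w" and B: "\<And>i. i \<in> {1..k} \<Longrightarrow> positive_definite (B i)"
  shows "\<exists>c>0. \<forall>t\<in>{0..1}. \<forall>X. symmetric_matrix X \<longrightarrow>
    c * norm X ^ count_list w LX \<le> norm (word_matrix w X (\<lambda>i. (1 - t) *\<^sub>R mat 1 + t *\<^sub>R B i))"
proof -
  let ?B = "\<lambda>t i. (1 - t) *\<^sub>R mat 1 + t *\<^sub>R B i"
  let ?f = "\<lambda>z. word_matrix w (snd z) (?B (fst z))"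
  let ?K = "{0..1} \<times> (sphere 0 1 \<inter> {Y :: real^'n^'n. symmetric_matrix Y})"
  have "compact (?f ` ?K)"
    by (intro compact_continuous_image continuous_on_word_matrix continuous_intros compact_Times
        compact_Int_closed closed_symmetric_matrices) auto
  moreover have "0 \<notin> ?f ` ?K"
  proof
    assume "0 \<in> ?f ` ?K"
    then obtain t Y where t: "t \<in> {0..1}" and Y: "symmetric_matrix Y" "norm Y = 1"
      and 0: "word_matrix w Y (?B t) = 0" by auto
    have "word_matrix w Y (?B t) \<noteq> 0"
    proof (rule interlaced_word_matrix_nonzero[OF w Y(1)])
      show "Y \<noteq> 0" using Y(2) by auto
      show "positive_definite (?B t i)" if "i \<in> {1..k}" for i
        by (rule positive_definite_convex[OF positive_definite_mat_1 B[OF that] t])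
    qed
    then show False using 0 by simp
  qed
  ultimately have "open (- (?f ` ?K))" "0 \<in> - (?f ` ?K)" by (auto intro: compact_imp_closed)
  then obtain c where c: "0 < c" "ball 0 c \<subseteq> - (?f ` ?K)" by (meson openE)
  have "c * norm X ^ count_list w LX \<le> norm (word_matrix w X (?B t))"
    if t: "t \<in> {0..1}" and X: "symmetric_matrix X" for t X
  proof (cases "X = 0")
    case True
    \<comment> \<open>At \<open>X = 0\<close> the bound rests on the exponent being positive, as
      \<open>0 ^ 0\<close> would be 1.\<close>
    have "count_list w LX \<noteq> 0" using interlaced_letters(1)[OF w] by (simp add: count_list_0_iff)
    then show ?thesis using True by (simp add: power_0_left)
  next
    case False
    let ?Y = "X /\<^sub>R norm X"
    have "symmetric_matrix ?Y" using X by (simp add: symmetric_matrix_def transpose_def vec_eq_iff)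
    then have "(t, ?Y) \<in> ?K" using t False by simp
    then have "?f (t, ?Y) \<in> ?f ` ?K" by (rule imageI)
    then have "?f (t, ?Y) \<notin> ball 0 c" using c(2) by blast
    then have le: "c \<le> norm (word_matrix w ?Y (?B t))" by simp
    have "word_matrix w X (?B t) = word_matrix w (norm X *\<^sub>R ?Y) (?B t)" using False by simp
    also have "\<dots> = norm X ^ count_list w LX *\<^sub>R word_matrix w ?Y (?B t)" by (rule word_matrix_scaleR)
    finally have "norm (word_matrix w X (?B t)) = norm X ^ count_list w LX * norm (word_matrix w ?Y (?B t))"
      by (simp only: norm_scaleR power_abs abs_norm_cancel)
    then show ?thesis
      using mult_right_mono[OF le, of "norm X ^ count_list w LX"] by (simp only: mult.commute zero_le_power norm_ge_zero)
  qed
  then show ?thesis using c(1) by blast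
qed

lemma real_polynomial_function_low_of_word_matrix:
  "real_polynomial_function (\<lambda>x. low_of (word_matrix w (sym_of x) C) $ l)"
proof -
  have "real_polynomial_function (\<lambda>x. sym_of x $ i $ j)" for i j
    by (rule real_polynomial_function.intros(1)) (rule bounded_linear_compose[OF bounded_linear_vec_nth
        bounded_linear_compose[OF bounded_linear_vec_nth bounded_linear_sym_of]])
  then show ?thesis
    unfolding low_of_def
    by (simp, intro real_polynomial_function_word_matrix real_polynomial_function.intros(2))
qed

text \<open>The degree theorem is applied to the segment homotopy on the positive definite matrices
  of norm below \<open>R\<close>. Its starting equation has exactly one solution there, and at the
  end all solutions lie in this region.\<close>

lemma odd_card_solutions_of_regular_value:
  fixes B :: "nat \<Rightarrow> real^'n::{finite,wellorder}^'n::_"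
  assumes w: "interlaced k w" "symmetric_word w"
    and B: "\<And>i. i \<in> {1..k} \<Longrightarrow> positive_definite (B i)"
    and P: "positive_definite P"
    and reg: "\<And>x. word_matrix w (sym_of x) B = P \<Longrightarrow>
      det (jacobian (\<lambda>x. low_of (word_matrix w (sym_of x) B)) x) \<noteq> 0"
  shows "odd (card {X. positive_definite X \<and> word_matrix w X B = P})"
proof -
  let ?d = "count_list w LX"
  let ?B = "\<lambda>t i. (1 - t) *\<^sub>R mat 1 + t *\<^sub>R B i"
  let ?P = "\<lambda>t. (1 - t) *\<^sub>R mat 1 + t *\<^sub>R P"
  define H where "H z = low_of (word_matrix w (sym_of (snd z)) (?B (fst z)) - ?P (fst z))"
    for z :: "real \<times> (real^'n::_ lower)"
  obtain c where c: "0 < c" "\<And>t X. t \<in> {0..1} \<Longrightarrow> symmetric_matrix X \<Longrightarrow>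
    c * norm X ^ ?d \<le> norm (word_matrix w X (?B t))"
    using word_matrix_norm_lower_bound[where B = B, OF w(1) B] by blast
  have d: "0 < ?d" using interlaced_letters(1)[OF w(1)] count_list_0_iff[of w LX] by simp
  define M where "M = norm (mat 1 :: real^'n::_^'n::_) + norm P"
  \<comment> \<open>Beyond this radius \<open>norm X\<close> is at least 1, so its
    \<open>?d\<close>-th power is at least \<open>norm X\<close>, which exceeds
    \<open>M / c\<close>; the added 1 makes this strict. \<open>M\<close> bounds the norm of every
    \<open>?P t\<close>.\<close>
  define R where "R = max 1 (M / c) + 1"
  have PDB: "positive_definite (?B t i)" if "t \<in> {0..1}" "i \<in> {1..k}" for t i
    by (rule positive_definite_convex[OF positive_definite_mat_1 B[OF that(2)] that(1)])
  have PDP: "positive_definite (?P t)" if "t \<in> {0..1}" for t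
    by (rule positive_definite_convex[OF positive_definite_mat_1 P that])
  have symw: "symmetric_matrix (word_matrix w X (?B t))" if "t \<in> {0..1}" "symmetric_matrix X" for t X
    by (rule symmetric_word_matrix[OF w(2) that(2)])
      (use PDB[OF that(1)] interlaced_letters(2)[OF w(1)] in \<open>auto simp: positive_definite_iff\<close>)
  \<comment> \<open>Comparing lower triangles decides equality because both sides are symmetric; for
    the word this uses that it is a palindrome.\<close>
  have H0: "H (t, x) = 0 \<longleftrightarrow> word_matrix w (sym_of x) (?B t) = ?P t" if "t \<in> {0..1}" for t x
  proof -
    have "H (t, x) = low_of (word_matrix w (sym_of x) (?B t)) - low_of (?P t)"
      by (simp add: H_def linear_diff[OF bounded_linear.linear[OF bounded_linear_low_of]])
    then show ?thesis
      using low_of_eq_iff[OF symw[OF that symmetric_sym_of]] PDP[OF that] by (simp add: positive_definite_iff)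
  qed
  have bound: "norm X < R" if t: "t \<in> {0..1}" and X: "symmetric_matrix X" "word_matrix w X (?B t) = ?P t" for t X
  proof (rule ccontr)
    assume "\<not> norm X < R"
    then have n: "1 \<le> norm X" "M / c < norm X" by (auto simp: R_def)
    have "norm (?P t) \<le> norm ((1 - t) *\<^sub>R mat 1 :: real^'n::_^'n::_) + norm (t *\<^sub>R P)" by (rule norm_triangle_ineq)
    also have "\<dots> \<le> M" unfolding M_def norm_scaleR
      using t by (intro add_mono mult_left_le_one_le) auto
    finally have "c * norm X ^ ?d \<le> M" using c(2)[OF t X(1)] X(2) by simp
    moreover have "norm X ^ 1 \<le> norm X ^ ?d" by (rule power_increasing) (use d n in auto)
    then have "c * norm X \<le> c * norm X ^ ?d" using c(1) by simp
    ultimately have "c * norm X \<le> M" by linarith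
    then show False using n(2) c(1) by (simp add: field_simps)
  qed
  define G :: "(real^('n::_ lower)) set"
    where "G = {x. positive_definite (sym_of x) \<and> norm (sym_of x) < R}"
  have cs: "continuous_on UNIV sym_of" by (rule linear_continuous_on[OF bounded_linear_sym_of])
  have G_eq: "G = sym_of -` {A. \<forall>v. v \<noteq> 0 \<longrightarrow> 0 < v \<bullet> (A *v v)} \<inter> {x. norm (sym_of x) < R}"
    by (auto simp: G_def positive_definite_iff symmetric_sym_of)
  have openG: "open G"
    unfolding G_eq
    by (intro open_Int open_vimage open_quadratic_form_pos cs open_Collect_less continuous_intros)
  have boundedG: "bounded G"
  proof -
    have "bounded (low_of ` cball 0 R)"
      by (intro bounded_linear_image bounded_cball bounded_linear_low_of)
    moreover have "G \<subseteq> low_of ` cball 0 R"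
    proof
      fix x assume "x \<in> G"
      then have "low_of (sym_of x) \<in> low_of ` cball 0 R" by (intro imageI) (simp add: G_def)
      then show "x \<in> low_of ` cball 0 R" by simp
    qed
    ultimately show ?thesis by (rule bounded_subset)
  qed
  \<comment> \<open>Excludes zeros on the frontier: in the closure the matrix is still semidefinite,
    the equation with invertible \<open>?P t\<close> makes it invertible, hence positive definite,
    and the norm bound is strict.\<close>
  have zeroG: "x \<in> G" if t: "t \<in> {0..1}" and x: "x \<in> closure G" and eq: "H (t, x) = 0" for t x
  proof -
    have "closed (\<Inter>v. {x :: real^('n lower). 0 \<le> v \<bullet> (sym_of x *v v)})"
    proof (intro closed_INT ballI closed_Collect_le continuous_on_const)
      fix v :: "real^'n::_"
      have "linear (\<lambda>A :: real^'n::_^'n::_. A *v v)"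
        by (intro linearI) (simp_all add: matrix_vector_mult_add_rdistrib scaleR_matrix_vector_assoc)
      then have "continuous_on UNIV (\<lambda>A :: real^'n::_^'n::_. A *v v)"
        by (intro linear_continuous_on) (simp add: linear_conv_bounded_linear)
      then have "continuous_on UNIV (\<lambda>x. sym_of x *v v)"
        by (rule continuous_on_compose2[OF _ cs]) simp
      then show "continuous_on UNIV (\<lambda>x. v \<bullet> (sym_of x *v v))"
        by (intro continuous_on_inner continuous_on_const)
    qed
    moreover have "G \<subseteq> (\<Inter>v. {x. 0 \<le> v \<bullet> (sym_of x *v v)})"
    proof (intro subsetI INT_I CollectI)
      fix y v assume "y \<in> G"
      then show "0 \<le> v \<bullet> (sym_of y *v v)"
        by (cases "v = 0") (auto simp: G_def positive_definite_iff order_less_imp_le)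
    qed
    ultimately have psd: "0 \<le> v \<bullet> (sym_of x *v v)" for v using closure_minimal x by blast
    have W: "word_matrix w (sym_of x) (?B t) = ?P t" using eq H0[OF t] by simp
    then have "det (word_matrix w (sym_of x) (?B t)) \<noteq> 0"
      using positive_definite_det_nonzero[OF PDP[OF t]] by simp
    then have "det (sym_of x) \<noteq> 0" by (rule det_word_matrix_nonzero[OF interlaced_letters(1)[OF w(1)]])
    then have "positive_definite (sym_of x)"
      by (rule semidefinite_det_nonzero_imp_positive_definite[OF symmetric_sym_of psd])
    then show ?thesis using bound[OF t symmetric_sym_of W] by (simp add: G_def)
  qed
  have poly_snd: "real_polynomial_function (\<lambda>z. sym_of (snd z) $ i $ j)" for i j :: 'n
    by (rule real_polynomial_function.intros(1)) (intro bounded_linear_compose[OF bounded_linear_vec_nth]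
        bounded_linear_compose[OF bounded_linear_sym_of] bounded_linear_snd)
  have poly_fst: "real_polynomial_function fst"
    by (rule real_polynomial_function.intros(1)) (rule bounded_linear_fst)
  have poly_segment: "real_polynomial_function
      (\<lambda>z :: real \<times> (real^('n lower)). ((1 - fst z) *\<^sub>R A + fst z *\<^sub>R C) $ i $ j)"
    for A C :: "real^'n::_^'n::_" and i j
    by simp (intro real_polynomial_function.intros(2-4) real_polynomial_function_diff poly_fst)
  have poly: "real_polynomial_function (\<lambda>z. H z $ l)" for l
    by (simp only: H_def low_of_def vec_lambda_beta vector_minus_component)
      (intro real_polynomial_function_diff real_polynomial_function_word_matrix poly_snd poly_segment)
  let ?W = "\<lambda>C x. low_of (word_matrix w (sym_of x) C)"
  have H_const: "(\<lambda>x. H (0, x)) = (\<lambda>x. ?W (\<lambda>_. mat 1) x - low_of (mat 1))"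
    "(\<lambda>x. H (1, x)) = (\<lambda>x. ?W B x - low_of P)"
    by (simp_all add: H_def linear_diff[OF bounded_linear.linear[OF bounded_linear_low_of]])
  have sol0: "sym_of x = mat 1" if "x \<in> G" "H (0, x) = 0" for x
  proof (rule power_eq_identity_imp_eq_mat_1[OF _ d])
    show "positive_definite (sym_of x)" using that(1) by (simp add: G_def)
    show "(((*v) (sym_of x)) ^^ ?d) v = v" for v
      using that(2) H0[of 0 x] by (simp flip: word_matrix_mat_1_letters)
  qed
  \<comment> \<open>The only candidate is the identity matrix, where the derivative is
    multiplication by the positive number \<open>?d\<close>.\<close>
  have reg0: "det (jacobian (\<lambda>x. H (0, x)) x) \<noteq> 0" if "x \<in> G" "H (0, x) = 0" for x
  proof -
    have "((\<lambda>x. word_matrix w (sym_of x) (\<lambda>_. mat 1)) has_derivative (\<lambda>v. real ?d *\<^sub>R sym_of v)) (at x)"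
      using has_derivative_compose[OF bounded_linear_imp_has_derivative[OF bounded_linear_sym_of],
          of "\<lambda>X. word_matrix w X (\<lambda>_. mat 1)" "\<lambda>V. real ?d *\<^sub>R V" x UNIV]
        has_derivative_word_matrix_mat_1[of w] sol0[OF that] by simp
    then have "(?W (\<lambda>_. mat 1) has_derivative (\<lambda>v. low_of (real ?d *\<^sub>R sym_of v))) (at x)"
      by (rule bounded_linear.has_derivative[OF bounded_linear_low_of])
    then have "((\<lambda>x. H (0, x)) has_derivative (\<lambda>v. low_of (real ?d *\<^sub>R sym_of v) - 0)) (at x)"
      unfolding H_const by (rule has_derivative_diff[OF _ has_derivative_const])
    moreover have "(\<lambda>v. low_of (real ?d *\<^sub>R sym_of v) - 0) = (*v) (real ?d *\<^sub>R mat 1 :: real^('n lower)^('n lower))"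
      by (simp add: fun_eq_iff linear_scale[OF bounded_linear.linear[OF bounded_linear_low_of]]
          scaleR_matrix_vector_assoc[symmetric])
    ultimately have "((\<lambda>x. H (0, x)) has_derivative (*v) (real ?d *\<^sub>R mat 1)) (at x)" by (simp only:)
    then have "jacobian (\<lambda>x. H (0, x)) x = real ?d *\<^sub>R mat 1"
      by (rule jacobian_eqI[OF real_polynomial_function_Pair[OF poly]])
    then show ?thesis
      using d by (auto simp: det_eq_0_iff_kernel scaleR_matrix_vector_assoc[symmetric])
  qed
  have reg1: "det (jacobian (\<lambda>x. H (1, x)) x) \<noteq> 0" if "H (1, x) = 0" for x
  proof -
    have "((\<lambda>x. H (1, x)) has_derivative (\<lambda>v. jacobian (?W B) x *v v - 0)) (at x)"
      unfolding H_const
      by (rule has_derivative_diff[OF has_derivative_jacobian[OF real_polynomial_function_low_of_word_matrix] has_derivative_const])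
    then have "jacobian (\<lambda>x. H (1, x)) x = jacobian (?W B) x"
      by (intro jacobian_eqI real_polynomial_function_Pair[OF poly]) simp
    then show ?thesis using reg[of x] H0[of 1 x] that by simp
  qed
  have "odd (card {x \<in> G. H (0, x) = 0}) \<longleftrightarrow> odd (card {x \<in> G. H (1, x) = 0})"
  proof (rule odd_card_zeros_homotopy[OF poly openG boundedG])
    show "H (t, x) \<noteq> 0" if "t \<in> {0..1}" "x \<in> frontier G" for t x
      using zeroG[OF that(1), of x] that(2) openG by (auto simp: frontier_def interior_open)
    show "det (jacobian (\<lambda>x. H (t, x)) x) \<noteq> 0" if "t \<in> {0, 1}" "x \<in> G" "H (t, x) = 0" for t x
      using that reg0[of x] reg1[of x] by auto
  qed
  moreover have "{x \<in> G. H (0, x) = 0} = {low_of (mat 1)}"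
  proof (intro set_eqI iffI)
    fix x assume "x \<in> {x \<in> G. H (0, x) = 0}"
    then have "low_of (sym_of x) = low_of (mat 1)" using sol0[of x] by simp
    then show "x \<in> {low_of (mat 1)}" by simp
  next
    fix x :: "real^('n lower)" assume "x \<in> {low_of (mat 1)}"
    then have x: "sym_of x = mat 1" by (simp add: sym_of_low_of symmetric_matrix_def)
    then have W: "word_matrix w (sym_of x) (?B 0) = ?P 0" by (simp add: word_matrix_mat_1)
    have "norm (sym_of x) < R" by (rule bound[OF _ symmetric_sym_of W]) simp
    then have "x \<in> G" using x positive_definite_mat_1 by (simp add: G_def)
    then show "x \<in> {x \<in> G. H (0, x) = 0}" using W H0[of 0 x] by simp
  qed
  ultimately have "odd (card {x \<in> G. H (1, x) = 0})" by simp
  also have "card {x \<in> G. H (1, x) = 0} = card (sym_of ` {x \<in> G. H (1, x) = 0})"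
    by (rule card_image[symmetric]) (simp add: inj_on_def sym_of_inject)
  also have "sym_of ` {x \<in> G. H (1, x) = 0} = {X. positive_definite X \<and> word_matrix w X B = P}"
  proof (intro set_eqI iffI)
    fix X assume "X \<in> sym_of ` {x \<in> G. H (1, x) = 0}"
    then show "X \<in> {X. positive_definite X \<and> word_matrix w X B = P}"
      using H0[of 1] by (auto simp: G_def)
  next
    fix X assume X: "X \<in> {X. positive_definite X \<and> word_matrix w X B = P}"
    then have sym: "symmetric_matrix X" by (simp add: positive_definite_def)
    \<comment> \<open>The norm bound places every positive definite solution inside
      \<open>G\<close>, so none is missed by the count.\<close>
    have "norm X < R" by (rule bound[of 1, OF _ sym]) (use X in simp_all)
    then have "low_of X \<in> {x \<in> G. H (1, x) = 0}"
      using X H0[of 1 "low_of X"] by (simp add: G_def sym_of_low_of[OF sym])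
    then have "sym_of (low_of X) \<in> sym_of ` {x \<in> G. H (1, x) = 0}" by (rule imageI)
    then show "X \<in> sym_of ` {x \<in> G. H (1, x) = 0}" by (simp add: sym_of_low_of[OF sym])
  qed
  finally show ?thesis .
qed

section \<open>Almost every right-hand side is a regular value\<close>

theorem corollary1p6:
  fixes k :: nat
    and S :: word
    and B :: "nat \<Rightarrow> real^'n::{finite,wellorder}^'n::{finite,wellorder}"
  assumes "1 \<le> k"
    and "interlaced k S"
    and "symmetric_word S"
    and "\<forall>i\<in>{1..k}. positive_definite (B i)"
  shows "AE P in lebesgue_symmetric. positive_definite P \<longrightarrow>
    finite {X. positive_definite X \<and> word_matrix S X B = P} \<and>
    odd (card {X. positive_definite X \<and> word_matrix S X B = P})"
proof -
  let ?\<Phi> = "\<lambda>x. low_of (word_matrix S (sym_of x) B)"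
  let ?C = "{x. det (jacobian ?\<Phi> x) = 0}"
  have poly: "real_polynomial_function (\<lambda>x. ?\<Phi> x $ l)" for l
    by (rule real_polynomial_function_low_of_word_matrix)
  \<comment> \<open>Sard's theorem: a singular Jacobian has rank below the dimension, so the
    critical values form a null set.\<close>
  have "negligible (?\<Phi> ` ?C)"
  proof (rule baby_Sard)
    show "(?\<Phi> has_derivative (*v) (jacobian ?\<Phi> x)) (at x within ?C)" for x
      by (rule has_derivative_at_withinI[OF has_derivative_jacobian[OF poly]])
    show "rank (matrix ((*v) (jacobian ?\<Phi> x))) < CARD('n lower)" if "x \<in> ?C" for x
      using that by (simp add: det_eq_0_rank)
  qed simp
  then show ?thesis
  proof (rule AE_lebesgue_symmetric_if_negligible, intro impI)
    fix p assume p: "p \<notin> ?\<Phi> ` ?C" and P: "positive_definite (sym_of p)"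
    have odd: "odd (card {X. positive_definite X \<and> word_matrix S X B = sym_of p})"
    proof (rule odd_card_solutions_of_regular_value[OF assms(2,3) _ P])
      show "positive_definite (B i)" if "i \<in> {1..k}" for i using assms(4) that by blast
      show "det (jacobian ?\<Phi> x) \<noteq> 0" if "word_matrix S (sym_of x) B = sym_of p" for x
      proof
        assume "det (jacobian ?\<Phi> x) = 0"
        then have "?\<Phi> x \<in> ?\<Phi> ` ?C" by blast
        then show False using p that by simp
      qed
    qed
    moreover have "finite {X. positive_definite X \<and> word_matrix S X B = sym_of p}"
      \<comment> \<open>An infinite set has \<open>card\<close> 0, which is even, so oddness already
        implies finiteness.\<close>
      by (rule ccontr) (use odd in simp)
    ultimately show "finite {X. positive_definite X \<and> word_matrix S X B = sym_of p} \<and>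
        odd (card {X. positive_definite X \<and> word_matrix S X B = sym_of p})" by blast
  qed
qed

end
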